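(* Let $\mathrm{NaivePME}_{\rho,\alpha,\beta,R,\kappa}$ be the algorithm which, on input $X_1,\dots,X_n\in\mathbb{R}^d$, sets $\rho'=\rho/d$, $\alpha'=\alpha/(\kappa\sqrt d)$, $\beta'=\beta/d$, and for each $j=1,\dots,d$ sets $\hat\mu_j\gets\mathrm{KVMean}_{\rho',\alpha',\beta',R,\kappa}(X_{1,j},\dots,X_{n,j})$, returning $\hat\mu=(\hat\mu_1,\dots,\hat\mu_d)$. For every $\rho,\alpha,\beta,R,\kappa>0$, $\mathrm{NaivePME}_{\rho,\alpha,\beta,R,\kappa}$ is $\rho$-zCDP and there is an $$n=O\left(\frac{\kappa^2d\log(\frac d\beta)}{\alpha^2}+\frac{\kappa d\log(\frac{\kappa d\log R}{\alpha\beta\rho})}{\alpha\rho^{1/2}}+\frac{\sqrt d\log^{1/2}(\frac{Rd}{\beta})}{\rho^{1/2}}\right)$$ such that if $X_1,\dots,X_n\sim\mathcal{N}(\mu,\Sigma)$ i.i.d. for $\|\mu\|_2\le R$ and $\mathbb{I}\preceq\Sigma\preceq\kappa\mathbb{I}$, then with probability at least $1-\beta$, $\mathrm{NaivePME}$ outputs $\hat\mu$ with $\|\mu-\hat\mu\|_\Sigma\le\alpha$.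
   Context: $\mathrm{KVMean}_{\rho,\alpha,\beta,R,\kappa}$ denotes the (zCDP variant of the) univariate private mean estimator of Karwa and Vadhan: it is $\rho$-zCDP, and there is an $n=O\left(\frac{\log(1/\beta)}{\alpha^2}+\frac{\log(\frac{\log R}{\alpha\beta\rho})}{\alpha\rho^{1/2}}+\frac{\log^{1/2}(R/\beta)}{\rho^{1/2}}\right)$ such that given $n$ i.i.d. samples from $\mathcal{N}(\mu,\sigma^2)$ with $|\mu|\le R$ and $1\le\sigma^2\le\kappa$, with probability at least $1-\beta$ it outputs $\hat\mu$ with $|\mu-\hat\mu|\le\alpha\kappa$. For a vector $v$, $\|v\|_\Sigma=\|\Sigma^{-1/2}v\|_2$. An algorithm $M$ is $\rho$-zCDP if for all datasets $X,X'$ differing in one entry and all $\alpha>1$, the Rényi divergence $D_\alpha(M(X)\|M(X'))\le\rho\alpha$.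
   Formalization: Here log in the sample bounds (also KVMean's) means max(1, ln), and the O-constant is uniform over all parameters with α ≤ A, for each fixed A > 0, rather than over all α > 0; an absolute constant would force n = 0 for some large α and ρ. *)

theory Defs
  imports "HOL-Probability.Probability" "Jordan_Normal_Form.Gauss_Jordan_Elimination"
begin

section \<open>Randomized algorithms and zCDP\<close>

text \<open>
  A dataset of size \<open>n\<close> over \<open>\<X>\<close> is an element of \<open>space (\<Pi>\<^sub>M i\<in>{..<n}. \<X>)\<close>, i.e. a function on
  \<open>{..<n}\<close>. An algorithm \<open>M\<close> accepts datasets of every size: \<open>M n X\<close> is the law of its output on
  the dataset \<open>X\<close> of size \<open>n\<close>, and it has to depend measurably on \<open>X\<close> (Markov kernel).
\<close>

definition randomized_algorithm ::
    "'x measure \<Rightarrow> 'y measure \<Rightarrow> (nat \<Rightarrow> (nat \<Rightarrow> 'x) \<Rightarrow> 'y measure) \<Rightarrow> bool" where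
  "randomized_algorithm \<X> \<Y> M \<longleftrightarrow> (\<forall>n. M n \<in> (\<Pi>\<^sub>M i\<in>{..<n}. \<X>) \<rightarrow>\<^sub>M prob_algebra \<Y>)"

text \<open>
  \<open>D\<^sub>\<alpha>(P \<parallel> Q) = 1/(\<alpha> - 1) * log (\<integral> (dP/dQ)\<^sup>\<alpha> dQ)\<close> for \<open>\<alpha> > 1\<close>, which is \<open>\<infinity>\<close> if the integral diverges
  or if \<open>P\<close> is not absolutely continuous with respect to \<open>Q\<close>. Note the order of the arguments of
  \<^const>\<open>absolutely_continuous\<close> and \<^const>\<open>RN_deriv\<close>: the dominating measure comes first.
\<close>

definition renyi_divergence :: "real \<Rightarrow> 'y measure \<Rightarrow> 'y measure \<Rightarrow> ereal" where
  "renyi_divergence \<alpha> P Q =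
    (let I = \<integral>\<^sup>+ y. ennreal (enn2real (RN_deriv Q P y) powr \<alpha>) \<partial>Q
     in if absolutely_continuous Q P \<and> I < \<infinity> then ereal (ln (enn2real I) / (\<alpha> - 1)) else \<infinity>)"

definition zCDP ::
    "'x measure \<Rightarrow> 'y measure \<Rightarrow> real \<Rightarrow> (nat \<Rightarrow> (nat \<Rightarrow> 'x) \<Rightarrow> 'y measure) \<Rightarrow> bool" where
  "zCDP \<X> \<Y> \<rho> M \<longleftrightarrow>
     randomized_algorithm \<X> \<Y> M \<and>
     (\<forall>n. \<forall>X\<in>space (\<Pi>\<^sub>M i\<in>{..<n}. \<X>). \<forall>X'\<in>space (\<Pi>\<^sub>M i\<in>{..<n}. \<X>).
        (\<exists>i<n. \<forall>k<n. k \<noteq> i \<longrightarrow> X k = X' k) \<longrightarrow>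
        (\<forall>\<alpha>>1. renyi_divergence \<alpha> (M n X) (M n X') \<le> ereal (\<rho> * \<alpha>)))"

text \<open>Law of the output on \<open>n\<close> i.i.d. samples from \<open>P\<close>; the randomness is that of the samples and of
  the algorithm.\<close>

definition output_on_samples ::
    "(nat \<Rightarrow> (nat \<Rightarrow> 'x) \<Rightarrow> 'y measure) \<Rightarrow> nat \<Rightarrow> 'x measure \<Rightarrow> 'y measure" where
  "output_on_samples M n P = (\<Pi>\<^sub>M i\<in>{..<n}. P) \<bind> M n"


section \<open>Gaussians on \<open>\<real>\<^sup>d\<close> and the norm \<open>\<parallel>\<cdot>\<parallel>\<^sub>\<Sigma>\<close>\<close>

text \<open>The dimension \<open>d\<close> is a number and not a type, because the constants hidden in \<open>O(\<cdot>)\<close> must not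
  depend on it. Points of \<open>\<real>\<^sup>d\<close> are functions on \<open>{..<d}\<close>.\<close>

abbreviation Rvec :: "nat \<Rightarrow> (nat \<Rightarrow> real) measure" where
  "Rvec d \<equiv> (\<Pi>\<^sub>M j\<in>{..<d}. borel)"

definition psd_mat :: "real mat \<Rightarrow> bool" where
  "psd_mat A \<longleftrightarrow> square_mat A \<and> A\<^sup>T = A \<and>
     (\<forall>v\<in>carrier_vec (dim_row A). 0 \<le> v \<bullet> (A *\<^sub>v v))"

definition loewner_le :: "real mat \<Rightarrow> real mat \<Rightarrow> bool" (infix \<open>\<preceq>\<close> 50) where
  "A \<preceq> B \<longleftrightarrow> psd_mat (B - A)"

definition mat_sqrt :: "real mat \<Rightarrow> real mat" where
  "mat_sqrt A = (THE B. psd_mat B \<and> B * B = A)"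

text \<open>Law of \<open>\<mu> + \<Sigma>\<^bsup>1/2\<^esup> Z\<close> for a standard Gaussian vector \<open>Z\<close>.\<close>

definition mv_gaussian :: "nat \<Rightarrow> (nat \<Rightarrow> real) \<Rightarrow> real mat \<Rightarrow> (nat \<Rightarrow> real) measure" where
  "mv_gaussian d \<mu> \<Sigma> =
     distr (\<Pi>\<^sub>M j\<in>{..<d}. density lborel std_normal_density) (Rvec d)
       (\<lambda>z. \<lambda>j\<in>{..<d}. \<mu> j + (mat_sqrt \<Sigma> *\<^sub>v vec d z) $ j)"

definition norm_wrt :: "nat \<Rightarrow> real mat \<Rightarrow> (nat \<Rightarrow> real) \<Rightarrow> real" where
  "norm_wrt d \<Sigma> v = L2_set (\<lambda>j. (the (mat_inverse (mat_sqrt \<Sigma>)) *\<^sub>v vec d v) $ j) {..<d}"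


section \<open>The estimator\<close>

text \<open>\<open>KVMean \<rho> \<alpha> \<beta> R \<kappa>\<close> is an arbitrary univariate estimator. The \<open>d\<close> calls use independent
  randomness, so the output law is the product of the laws of the coordinates.\<close>

definition NaivePME ::
    "(real \<Rightarrow> real \<Rightarrow> real \<Rightarrow> real \<Rightarrow> real \<Rightarrow> nat \<Rightarrow> (nat \<Rightarrow> real) \<Rightarrow> real measure) \<Rightarrow>
     nat \<Rightarrow> real \<Rightarrow> real \<Rightarrow> real \<Rightarrow> real \<Rightarrow> real \<Rightarrow> nat \<Rightarrow> (nat \<Rightarrow> nat \<Rightarrow> real) \<Rightarrow> (nat \<Rightarrow> real) measure" where
  "NaivePME KVMean d \<rho> \<alpha> \<beta> R \<kappa> n X =
    (let \<rho>' = \<rho> / real d; \<alpha>' = \<alpha> / (\<kappa> * sqrt (real d)); \<beta>' = \<beta> / real d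
     in \<Pi>\<^sub>M j\<in>{..<d}. KVMean \<rho>' \<alpha>' \<beta>' R \<kappa> n (\<lambda>i\<in>{..<n}. X i j))"

text \<open>The logarithm in sample complexity bounds, with the usual convention that it is at least \<open>1\<close>.
  Otherwise expressions such as \<open>log (log R / (\<alpha> \<beta> \<rho>))\<close> and \<open>log\<^bsup>1/2\<^esup> (R / \<beta>)\<close> are undefined or negative
  for some positive parameters. The constants in \<open>O(\<cdot>)\<close> are taken uniform over \<open>\<alpha> \<le> A\<close>, for each
  bound \<open>A\<close>, and over all values of the other parameters: as \<open>\<alpha>, \<rho> \<rightarrow> \<infinity>\<close> the bounds tend to \<open>0\<close>, so a
  constant uniform in \<open>\<alpha>\<close> would demand an estimator that works without samples.\<close>

definition lg :: "real \<Rightarrow> real" where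
  "lg x = max 1 (ln x)"

end

theory Submission
  imports Defs "Jordan_Normal_Form.Determinant"
begin

text \<open>
  Privacy: the density of a product of laws is the product of the densities, so the integral in the
  Renyi divergence factors over the coordinates, and \<open>d\<close> calls with budget \<open>\<rho> / d\<close> add up to \<open>\<rho>\<close>.

  Accuracy: coordinate \<open>j\<close> of the output is an output of the univariate estimator on samples of
  \<open>N(\<mu>\<^sub>j, \<Sigma>\<^sub>j\<^sub>j)\<close> with \<open>1 \<le> \<Sigma>\<^sub>j\<^sub>j \<le> \<kappa>\<close>. By a union bound all coordinates are within \<open>\<alpha> / sqrt d\<close> with
  probability at least \<open>1 - \<beta>\<close>, and \<open>\<parallel>v\<parallel>\<^sub>\<Sigma> \<le> \<parallel>v\<parallel>\<^sub>2\<close> because \<open>\<Sigma>\<close> is at least the identity.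
\<close>

text \<open>When \<Sigma> is not diagonal, the columns of the sample, and with them the coordinates
  of the output, may be dependent. The union bound uses only marginals, so it is enough to know the
  law of each single output coordinate: given the data it is the univariate law at one column, and a
  column of the sample is i.i.d. Gaussian. One \<open>n\<close> serves all coordinates because the
  univariate guarantee is uniform in mean and variance.

  The Gaussian law and the norm both refer to \<open>mat_sqrt\<close>, a definite description, so
  they say nothing until existence and uniqueness of the positive semidefinite root are known. Both
  are proved without eigenvalues: existence by a contracting iteration, uniqueness by a trace
  argument that relies on a strictly positive lower bound for the form of the constructed
  root.\<close>

no_notation inner (infix "\<bullet>" 70)

subsection \<open>Privacy\<close>


lemma density_PiM:
  fixes f :: "'i \<Rightarrow> 'a \<Rightarrow> ennreal"
  assumes Q: "\<And>j. prob_space (Q j)" and P: "\<And>j. prob_space (density (Q j) (f j))"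
    and fin: "finite I" and f [measurable]: "\<And>j. f j \<in> borel_measurable (Q j)"
  shows "density (PiM I Q) (\<lambda>y. \<Prod>j\<in>I. f j (y j)) = PiM I (\<lambda>j. density (Q j) (f j))"
proof -
  interpret Q: product_prob_space Q by (rule product_prob_spaceI) (rule Q)
  interpret P: product_prob_space "\<lambda>j. density (Q j) (f j)" by (rule product_prob_spaceI) (rule P)
  show ?thesis
  proof (rule P.PiM_eqI)
    show "sets (density (PiM I Q) (\<lambda>y. \<Prod>j\<in>I. f j (y j))) = sets (PiM I (\<lambda>j. density (Q j) (f j)))"
      by (simp cong: sets_PiM_cong)
  next
    fix A assume A: "\<And>j. j \<in> I \<Longrightarrow> A j \<in> sets (density (Q j) (f j))"
    \<comment> \<open>The indicator of a box splits over the coordinates, so it is absorbed into the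
      factors before the integral is factored. Boxes determine a law on the product.\<close>
    have box: "indicator (Pi\<^sub>E I A) y = (\<Prod>j\<in>I. indicator (A j) (y j) :: ennreal)"
      if "y \<in> space (PiM I Q)" for y
    proof (cases "\<forall>j\<in>I. y j \<in> A j")
      case True
      with that show ?thesis by (auto simp: indicator_def PiE_iff space_PiM)
    next
      case False
      then have "(\<Prod>j\<in>I. indicator (A j) (y j) :: ennreal) = 0"
        using fin by (intro prod_zero) (auto simp: indicator_def)
      with False show ?thesis by (auto simp: indicator_def PiE_iff)
    qed
    have "emeasure (density (PiM I Q) (\<lambda>y. \<Prod>j\<in>I. f j (y j))) (Pi\<^sub>E I A)
        = (\<integral>\<^sup>+y. (\<Prod>j\<in>I. f j (y j)) * indicator (Pi\<^sub>E I A) y \<partial>PiM I Q)"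
      using A fin by (subst emeasure_density) (auto intro!: sets_PiM_I_finite)
    also have "\<dots> = (\<integral>\<^sup>+y. (\<Prod>j\<in>I. f j (y j) * indicator (A j) (y j)) \<partial>PiM I Q)"
      by (intro nn_integral_cong) (simp add: box prod.distrib)
    also have "\<dots> = (\<Prod>j\<in>I. \<integral>\<^sup>+x. f j x * indicator (A j) x \<partial>Q j)"
      using A fin by (intro Q.product_nn_integral_prod) auto
    also have "\<dots> = (\<Prod>j\<in>I. emeasure (density (Q j) (f j)) (A j))"
      using A by (intro prod.cong) (auto simp: emeasure_density)
    finally show "emeasure (density (PiM I Q) (\<lambda>y. \<Prod>j\<in>I. f j (y j))) (Pi\<^sub>E I A)
      = (\<Prod>j\<in>I. emeasure (density (Q j) (f j)) (A j))" .
  qed (rule fin)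
qed

text \<open>This covers infinite factors too: \<open>enn2real\<close> sends infinity to 0, and a
  product with an infinite factor is infinite or 0.\<close>

lemma enn2real_prod: "enn2real (\<Prod>j\<in>I. f j) = (\<Prod>j\<in>I. enn2real (f j))"
  by (induction I rule: infinite_finite_induct) (auto simp: enn2real_mult)

lemma prod_mono_ennreal:
  fixes f g :: "'i \<Rightarrow> ennreal"
  assumes "\<And>j. j \<in> I \<Longrightarrow> f j \<le> g j"
  shows "prod f I \<le> prod g I"
  using assms by (induction I rule: infinite_finite_induct) (auto intro: mult_mono)

text \<open>Moves from logarithms in \<open>ereal\<close> to a bound in \<open>ennreal\<close>,
  where the integrals of the coordinates can be multiplied.\<close>

lemma renyi_divergence_le_iff:
  assumes "1 < \<alpha>" "0 \<le> c"
  shows "renyi_divergence \<alpha> P Q \<le> ereal c \<longleftrightarrow>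
    absolutely_continuous Q P \<and>
    (\<integral>\<^sup>+ y. ennreal (enn2real (RN_deriv Q P y) powr \<alpha>) \<partial>Q) \<le> ennreal (exp ((\<alpha> - 1) * c))"
proof -
  define I where "I = (\<integral>\<^sup>+ y. ennreal (enn2real (RN_deriv Q P y) powr \<alpha>) \<partial>Q)"
  have "ln (enn2real I) / (\<alpha> - 1) \<le> c \<longleftrightarrow> I \<le> ennreal (exp ((\<alpha> - 1) * c))" if "I < \<infinity>"
  proof (cases "I = 0")
    case True
    \<comment> \<open>Since \<open>ln 0 = 0\<close>, the left side reads
      \<open>0 \<le> c\<close>.\<close>
    then show ?thesis using assms by simp
  next
    case False
    with that obtain r where r: "I = ennreal r" "0 < r"
      by (cases I) (auto simp: ennreal_eq_0_iff)
    have "ln r / (\<alpha> - 1) \<le> c \<longleftrightarrow> ln r \<le> (\<alpha> - 1) * c"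
      using assms by (simp add: pos_divide_le_eq mult.commute)
    also have "\<dots> \<longleftrightarrow> r \<le> exp ((\<alpha> - 1) * c)"
      using r(2) by (metis exp_le_cancel_iff exp_ln)
    finally show ?thesis using r by (simp add: ennreal_le_iff)
  qed
  moreover have "I < \<infinity>" if "I \<le> ennreal (exp ((\<alpha> - 1) * c))"
    using that by (metis ennreal_less_top infinity_ennreal_def le_less_trans)
  ultimately show ?thesis
    unfolding renyi_divergence_def I_def[symmetric] Let_def by auto
qed

lemma renyi_divergence_PiM_le:
  assumes P: "\<And>j. prob_space (P j)" and Q: "\<And>j. prob_space (Q j)"
    and sets: "\<And>j. sets (P j) = sets (Q j)"
    and fin: "finite I" and \<alpha>: "1 < \<alpha>" and c: "\<And>j. 0 \<le> c j"
    and le: "\<And>j. renyi_divergence \<alpha> (P j) (Q j) \<le> ereal (c j)"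
  shows "renyi_divergence \<alpha> (PiM I P) (PiM I Q) \<le> ereal (\<Sum>j\<in>I. c j)"
proof -
  interpret Q: product_prob_space Q by (rule product_prob_spaceI) (rule Q)
  interpret P: product_prob_space P by (rule product_prob_spaceI) (rule P)
  have sf: "sigma_finite_measure (PiM I Q)"
    using Q by (intro prob_space_imp_sigma_finite prob_space_PiM)
  define f where "f j = RN_deriv (Q j) (P j)" for j
  have f [measurable]: "f j \<in> borel_measurable (Q j)" for j
    unfolding f_def by simp
  have ac: "absolutely_continuous (Q j) (P j)"
    and int: "(\<integral>\<^sup>+ y. ennreal (enn2real (f j y) powr \<alpha>) \<partial>Q j) \<le> ennreal (exp ((\<alpha> - 1) * c j))" for j
    using le[of j] \<alpha> c by (auto simp: renyi_divergence_le_iff f_def)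
  have dens: "density (Q j) (f j) = P j" for j
    unfolding f_def by (rule Q.M.density_RN_deriv[OF ac sets])
  define g where "g y = (\<Prod>j\<in>I. f j (y j))" for y
  have g [measurable]: "g \<in> borel_measurable (PiM I Q)"
    unfolding g_def by measurable
  have densI: "density (PiM I Q) g = PiM I P"
    using density_PiM[of Q f I] Q P fin by (simp add: dens g_def[abs_def])
  have "absolutely_continuous (PiM I Q) (PiM I P)"
    unfolding densI[symmetric] by (rule absolutely_continuousI_density) simp
  \<comment> \<open>The Radon-Nikodym derivative is determined only almost everywhere. As
    \<open>g\<close> is a density as well, the two agree outside a null set, which the integral
    ignores.\<close>
  moreover have "(\<integral>\<^sup>+ y. ennreal (enn2real (RN_deriv (PiM I Q) (PiM I P) y) powr \<alpha>) \<partial>PiM I Q)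
      = (\<integral>\<^sup>+ y. ennreal (enn2real (g y) powr \<alpha>) \<partial>PiM I Q)"
    using sigma_finite_measure.RN_deriv_unique[OF sf g densI] by (intro nn_integral_cong_AE) auto
  moreover have "\<dots> = (\<integral>\<^sup>+ y. (\<Prod>j\<in>I. ennreal (enn2real (f j (y j)) powr \<alpha>)) \<partial>PiM I Q)"
    by (simp add: g_def enn2real_prod prod_powr_distrib prod_ennreal)
  moreover have "\<dots> = (\<Prod>j\<in>I. \<integral>\<^sup>+ y. ennreal (enn2real (f j y) powr \<alpha>) \<partial>Q j)"
    using fin by (intro Q.product_nn_integral_prod) auto
  moreover have "\<dots> \<le> (\<Prod>j\<in>I. ennreal (exp ((\<alpha> - 1) * c j)))"
    by (rule prod_mono_ennreal) (rule int)
  moreover have "\<dots> = ennreal (exp ((\<alpha> - 1) * (\<Sum>j\<in>I. c j)))"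
    using fin by (simp add: prod_ennreal sum_distrib_left exp_sum)
  ultimately show ?thesis
    using \<alpha> c by (subst renyi_divergence_le_iff) (auto intro: sum_nonneg)
qed

text \<open>Measurability of a kernel can be tested on a generating system stable under
  intersection. On boxes the mass is a finite product of measurable functions.\<close>

lemma measurable_PiM_kernel:
  assumes fin: "finite I" and K: "\<And>j. j \<in> I \<Longrightarrow> K j \<in> M \<rightarrow>\<^sub>M prob_algebra (N j)"
  shows "(\<lambda>x. PiM I (\<lambda>j. K j x)) \<in> M \<rightarrow>\<^sub>M prob_algebra (PiM I N)"
proof (rule measurable_prob_algebra_generated[OF sets_PiM Int_stable_prod_algebra
    prod_algebra_sets_into_space])
  fix x assume x: "x \<in> space M"
  have Kx: "prob_space (K j x)" "sets (K j x) = sets (N j)" if "j \<in> I" for j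
    using measurable_space[OF K[OF that] x] by (auto simp: space_prob_algebra)
  show "prob_space (PiM I (\<lambda>j. K j x))" by (rule prob_space_PiM) (rule Kx)
  show "sets (PiM I (\<lambda>j. K j x)) = sets (PiM I N)" by (rule sets_PiM_cong) (auto simp: Kx)
next
  fix A assume "A \<in> prod_algebra I N"
  then obtain X where A: "A = Pi\<^sub>E I X" and X: "\<And>j. j \<in> I \<Longrightarrow> X j \<in> sets (N j)"
    using fin by (auto simp: prod_algebra_eq_finite)
  have "emeasure (PiM I (\<lambda>j. K j x)) A = (\<Prod>j\<in>I. emeasure (K j x) (X j))" if x: "x \<in> space M" for x
  proof -
    \<comment> \<open>\<open>product_prob_space\<close> asks for a probability law at every index,
      so a point mass is put outside \<open>I\<close>.\<close>
    define L where "L j = (if j \<in> I then K j x else return (count_space UNIV) undefined)" for j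
    have Kx: "prob_space (K j x)" "sets (K j x) = sets (N j)" if "j \<in> I" for j
      using measurable_space[OF K[OF that] x] by (auto simp: space_prob_algebra)
    interpret L: product_prob_space L
      by (rule product_prob_spaceI) (auto simp: L_def Kx prob_space_return)
    have "PiM I (\<lambda>j. K j x) = PiM I L" by (rule PiM_cong) (auto simp: L_def)
    also have "emeasure \<dots> A = (\<Prod>j\<in>I. emeasure (L j) (X j))"
      unfolding A using X by (intro L.emeasure_PiM fin) (auto simp: L_def Kx)
    finally show ?thesis by (simp add: L_def)
  qed
  moreover have "(\<lambda>x. \<Prod>j\<in>I. emeasure (K j x) (X j)) \<in> borel_measurable M"
    using X K by (intro borel_measurable_prod_ennreal)
      (auto intro!: measurable_emeasure_kernel measurable_prob_algebraD)
  ultimately show "(\<lambda>x. emeasure (PiM I (\<lambda>j. K j x)) A) \<in> borel_measurable M"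
    by (subst measurable_cong) auto
qed

lemma measurable_column [measurable]:
  assumes "j < d"
  shows "(\<lambda>X. \<lambda>i\<in>{..<n}. X i j) \<in> (\<Pi>\<^sub>M i\<in>{..<n::nat}. Rvec d) \<rightarrow>\<^sub>M (\<Pi>\<^sub>M i\<in>{..<n}. borel)"
proof (rule measurable_restrict)
  fix i assume "i \<in> {..<n}"
  moreover have "(\<lambda>x. x j) \<in> borel_measurable (Rvec d)"
    using assms by (intro measurable_component_singleton) auto
  ultimately show "(\<lambda>X. X i j) \<in> borel_measurable (\<Pi>\<^sub>M i\<in>{..<n}. Rvec d)"
    by (rule measurable_compose[OF measurable_component_singleton])
qed

lemma randomized_algorithm_NaivePME:
  assumes "\<And>\<rho> \<alpha> \<beta>. \<rho> > 0 \<Longrightarrow> \<alpha> > 0 \<Longrightarrow> \<beta> > 0 \<Longrightarrow> randomized_algorithm borel borel (KVMean \<rho> \<alpha> \<beta> R \<kappa>)"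
    and "d \<ge> 1" "\<rho> > 0" "\<alpha> > 0" "\<beta> > 0" "\<kappa> > 0"
  shows "randomized_algorithm (Rvec d) (Rvec d) (NaivePME KVMean d \<rho> \<alpha> \<beta> R \<kappa>)"
  unfolding randomized_algorithm_def NaivePME_def Let_def
proof (intro allI measurable_PiM_kernel)
  fix n j assume "j \<in> {..<d}"
  then show "(\<lambda>X. KVMean (\<rho> / real d) (\<alpha> / (\<kappa> * sqrt (real d))) (\<beta> / real d) R \<kappa> n (\<lambda>i\<in>{..<n}. X i j))
      \<in> (\<Pi>\<^sub>M i\<in>{..<n}. Rvec d) \<rightarrow>\<^sub>M prob_algebra borel"
    using assms by (intro measurable_compose[OF measurable_column])
      (auto simp: randomized_algorithm_def)
qed simp

lemma zCDP_NaivePME: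
  assumes KV: "\<And>\<rho> \<alpha> \<beta>. \<rho> > 0 \<Longrightarrow> \<alpha> > 0 \<Longrightarrow> \<beta> > 0 \<Longrightarrow> zCDP borel borel \<rho> (KVMean \<rho> \<alpha> \<beta> R \<kappa>)"
    and d: "d \<ge> 1" and pos: "\<rho> > 0" "\<alpha> > 0" "\<beta> > 0" "\<kappa> > 0"
  shows "zCDP (Rvec d) (Rvec d) \<rho> (NaivePME KVMean d \<rho> \<alpha> \<beta> R \<kappa>)"
  unfolding zCDP_def
proof (intro conjI allI impI ballI)
  show "randomized_algorithm (Rvec d) (Rvec d) (NaivePME KVMean d \<rho> \<alpha> \<beta> R \<kappa>)"
    using assms by (intro randomized_algorithm_NaivePME) (auto simp: zCDP_def)
next
  fix n :: nat and X X' :: "nat \<Rightarrow> nat \<Rightarrow> real" and a :: real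
  assume ex: "\<exists>i<n. \<forall>k<n. k \<noteq> i \<longrightarrow> X k = X' k" and a: "1 < a"
  define K where "K = KVMean (\<rho> / real d) (\<alpha> / (\<kappa> * sqrt (real d))) (\<beta> / real d) R \<kappa>"
  have K: "zCDP borel borel (\<rho> / real d) K"
    unfolding K_def using d pos by (intro KV) auto
  define col where "col X j = (\<lambda>i\<in>{..<n}. X i j)" 
    for X :: "nat \<Rightarrow> nat \<Rightarrow> real" and j :: nat
  have col: "col X j \<in> space (\<Pi>\<^sub>M i\<in>{..<n}. borel)" for X j
    by (auto simp: col_def space_PiM)
  have Kn: "K n \<in> (\<Pi>\<^sub>M i\<in>{..<n}. borel) \<rightarrow>\<^sub>M prob_algebra borel"
    using K by (simp add: zCDP_def randomized_algorithm_def)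
  have Kcol: "prob_space (K n (col X j))" "sets (K n (col X j)) = sets borel" for X j
    using measurable_space[OF Kn col] by (auto simp: space_prob_algebra)
  have ren: "renyi_divergence a (K n (col X j)) (K n (col X' j)) \<le> ereal (\<rho> / real d * a)" for j
  proof -
    \<comment> \<open>Replacing one sample changes at most one entry of each column, always in the
      same row, so all \<open>d\<close> calls see neighbouring inputs.\<close>
    have "\<exists>i<n. \<forall>k<n. k \<noteq> i \<longrightarrow> col X j k = col X' j k"
      using ex by (auto simp: col_def)
    then show ?thesis using K col a unfolding zCDP_def by blast
  qed
  have "renyi_divergence a (\<Pi>\<^sub>M j\<in>{..<d}. K n (col X j)) (\<Pi>\<^sub>M j\<in>{..<d}. K n (col X' j))
      \<le> ereal (\<Sum>j<d. \<rho> / real d * a)"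
    using pos a by (intro renyi_divergence_PiM_le ren) (auto simp: Kcol)
  also have "(\<Sum>j<d. \<rho> / real d * a) = \<rho> * a"
    using d by simp
  finally show "renyi_divergence a (NaivePME KVMean d \<rho> \<alpha> \<beta> R \<kappa> n X) (NaivePME KVMean d \<rho> \<alpha> \<beta> R \<kappa> n X')
      \<le> ereal (\<rho> * a)"
    unfolding NaivePME_def K_def col_def Let_def .
qed

subsection \<open>The positive semidefinite square root\<close>

definition vnorm :: "real vec \<Rightarrow> real" where "vnorm v = L2_set (\<lambda>i. v $ i) {..<dim_vec v}"

lemma scalar_prod_self: "(v :: real vec) \<bullet> v = (vnorm v)\<^sup>2"
  by (simp add: vnorm_def L2_set_def scalar_prod_def sum_nonneg power2_eq_square atLeast0LessThan)

lemma vnorm_nonneg [simp]: "0 \<le> vnorm v"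
  by (simp add: vnorm_def)

lemma vnorm_add_le: "dim_vec v = dim_vec w \<Longrightarrow> vnorm (v + w) \<le> vnorm v + vnorm w"
  unfolding vnorm_def using L2_set_triangle_ineq[of "\<lambda>i. v $ i" "\<lambda>i. w $ i" "{..<dim_vec w}"]
  by (simp add: L2_set_def cong: sum.cong_simp)

lemma vnorm_smult: "vnorm (c \<cdot>\<^sub>v v) = \<bar>c\<bar> * vnorm v"
  by (simp add: vnorm_def L2_set_def power_mult_distrib sum_distrib_left[symmetric] real_sqrt_mult
      cong: sum.cong_simp)

lemma abs_index_le_vnorm: "i < dim_vec v \<Longrightarrow> \<bar>v $ i\<bar> \<le> vnorm v"
  unfolding vnorm_def
  using member_le_L2_set[of "{..<dim_vec v}" i "\<lambda>i. \<bar>v $ i\<bar>"] by (simp add: L2_set_def)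

lemma abs_scalar_prod_le: "dim_vec v = dim_vec w \<Longrightarrow> \<bar>v \<bullet> w\<bar> \<le> vnorm v * vnorm w"
proof -
  assume "dim_vec v = dim_vec w"
  moreover have "\<bar>v \<bullet> w\<bar> \<le> (\<Sum>i<dim_vec w. \<bar>v $ i\<bar> * \<bar>w $ i\<bar>)"
    unfolding scalar_prod_def atLeast0LessThan abs_mult[symmetric] by (rule sum_abs)
  ultimately show ?thesis
    using L2_set_mult_ineq[of "\<lambda>i. v $ i" "\<lambda>i. w $ i" "{..<dim_vec w}"]
    by (simp add: vnorm_def)
qed

text \<open>An inequality with an arbitrary constant stands in for the operator norm, so no supremum
  has to be formed.\<close>

definition op_bound :: "nat \<Rightarrow> real \<Rightarrow> real mat \<Rightarrow> bool" where
  "op_bound d c M \<longleftrightarrow> (\<forall>v\<in>carrier_vec d. vnorm (M *\<^sub>v v) \<le> c * vnorm v)"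

lemma op_bound_mono: "op_bound d c M \<Longrightarrow> c \<le> c' \<Longrightarrow> op_bound d c' M"
  unfolding op_bound_def by (meson mult_right_mono order_trans vnorm_nonneg)

lemma op_bound_add:
  assumes "op_bound d a M" "op_bound d b N" "M \<in> carrier_mat d d" "N \<in> carrier_mat d d"
  shows "op_bound d (a + b) (M + N)"
  unfolding op_bound_def
proof
  fix v :: "real vec" assume v: "v \<in> carrier_vec d"
  have "vnorm ((M + N) *\<^sub>v v) \<le> vnorm (M *\<^sub>v v) + vnorm (N *\<^sub>v v)"
    using assms v by (subst add_mult_distrib_mat_vec[of _ d d]) (auto intro!: vnorm_add_le)
  also have "\<dots> \<le> a * vnorm v + b * vnorm v"
    using assms v by (intro add_mono) (auto simp: op_bound_def)
  finally show "vnorm ((M + N) *\<^sub>v v) \<le> (a + b) * vnorm v" by (simp add: algebra_simps)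
qed

lemma op_bound_mult:
  assumes "op_bound d a M" "op_bound d b N" "M \<in> carrier_mat d d" "N \<in> carrier_mat d d" "0 \<le> a"
  shows "op_bound d (a * b) (M * N)"
  unfolding op_bound_def
proof
  fix v :: "real vec" assume v: "v \<in> carrier_vec d"
  have "vnorm ((M * N) *\<^sub>v v) = vnorm (M *\<^sub>v (N *\<^sub>v v))"
    using assms v by simp
  also have "\<dots> \<le> a * vnorm (N *\<^sub>v v)"
    using assms v unfolding op_bound_def by simp
  also have "\<dots> \<le> a * (b * vnorm v)"
    using assms v by (intro mult_left_mono) (auto simp: op_bound_def)
  finally show "vnorm ((M * N) *\<^sub>v v) \<le> a * b * vnorm v" by simp
qed

lemma op_bound_smult:
  assumes "op_bound d a M" "M \<in> carrier_mat d d"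
  shows "op_bound d (\<bar>c\<bar> * a) (c \<cdot>\<^sub>m M)"
  unfolding op_bound_def
proof
  fix v :: "real vec" assume v: "v \<in> carrier_vec d"
  have "c \<cdot>\<^sub>m M *\<^sub>v v = c \<cdot>\<^sub>v (M *\<^sub>v v)"
    using assms v by (intro eq_vecI) auto
  then show "vnorm (c \<cdot>\<^sub>m M *\<^sub>v v) \<le> \<bar>c\<bar> * a * vnorm v"
    using assms v by (auto simp: vnorm_smult op_bound_def mult.assoc intro!: mult_left_mono)
qed

lemma vnorm_unit_vec: "i < d \<Longrightarrow> vnorm (unit_vec d i) = 1"
proof -
  assume "i < d"
  then have "(vnorm (unit_vec d i))\<^sup>2 = 1"
    unfolding scalar_prod_self[symmetric] by simp
  then show ?thesis using vnorm_nonneg[of "unit_vec d i"] by (simp only: power2_eq_1_iff) linarith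
qed

text \<open>The entry is a coordinate of the image of a unit vector. This converts decay of operator
  bounds into convergence of entries.\<close>

lemma abs_entry_le_op_bound:
  assumes "op_bound d c M" "M \<in> carrier_mat d d" "i < d" "j < d"
  shows "\<bar>M $$ (i, j)\<bar> \<le> c"
proof -
  have "M $$ (i, j) = (M *\<^sub>v unit_vec d j) $ i"
    using assms by simp
  also have "\<bar>\<dots>\<bar> \<le> vnorm (M *\<^sub>v unit_vec d j)"
    using assms by (intro abs_index_le_vnorm) simp
  also have "\<dots> \<le> c * vnorm (unit_vec d j)"
    using assms unfolding op_bound_def by simp
  finally show ?thesis using assms by (simp add: vnorm_unit_vec)
qed

lemma symmetric_scalar_prod:
  assumes "M\<^sup>T = (M :: real mat)" "M \<in> carrier_mat d d" "v \<in> carrier_vec d" "w \<in> carrier_vec d"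
  shows "(M *\<^sub>v v) \<bullet> w = v \<bullet> (M *\<^sub>v w)"
  using transpose_vec_mult_scalar[of M d d w v] assms 
  by (simp add: comm_scalar_prod[of "M *\<^sub>v v" d])

text \<open>With \<open>u = M v\<close>, expand the nonnegative form at \<open>v - u / q\<close>.\<close>

lemma op_bound_of_form_bound:
  assumes M: "M \<in> carrier_mat d d" "M\<^sup>T = M" and q: "0 < q"
    and nonneg: "\<And>v. v \<in> carrier_vec d \<Longrightarrow> 0 \<le> v \<bullet> (M *\<^sub>v v)"
    and le: "\<And>v. v \<in> carrier_vec d \<Longrightarrow> v \<bullet> (M *\<^sub>v v) \<le> q * (v \<bullet> v)"
  shows "op_bound d q M"
  unfolding op_bound_def
proof
  fix v :: "real vec" assume v: "v \<in> carrier_vec d"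
  define u where "u = M *\<^sub>v v"
  have u: "u \<in> carrier_vec d" and Mu: "M *\<^sub>v u \<in> carrier_vec d"
    using M v by (auto simp: u_def)
  define w where "w = v + (- (1/q)) \<cdot>\<^sub>v u"
  have w: "w \<in> carrier_vec d" using u v by (simp add: w_def)
  have "M *\<^sub>v w = u + (- (1/q)) \<cdot>\<^sub>v (M *\<^sub>v u)"
    using M u v by (simp add: w_def mult_add_distrib_mat_vec[of _ d d] mult_mat_vec[of _ d d] u_def)
  moreover have "v \<bullet> (M *\<^sub>v u) = u \<bullet> u"
    using symmetric_scalar_prod[OF M(2,1) v u] by (simp add: u_def)
  ultimately have "w \<bullet> (M *\<^sub>v w) = v \<bullet> u - 2 * (1/q) * (u \<bullet> u) + (1/q)\<^sup>2 * (u \<bullet> (M *\<^sub>v u))"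
    using u v Mu by (simp add: w_def add_scalar_prod_distrib[of _ d] scalar_prod_add_distrib[of _ d]
        power2_eq_square algebra_simps)
  with nonneg[OF w] have "0 \<le> v \<bullet> u - 2 * (1/q) * (u \<bullet> u) + (1/q)\<^sup>2 * (u \<bullet> (M *\<^sub>v u))"
    by simp
  \<comment> \<open>The form bound at \<open>u\<close> cancels half of the cross term and leaves u.u
    / q \<le> v.u. The same bound at \<open>v\<close> then controls v.u.\<close>
  also have "\<dots> \<le> v \<bullet> u - 2 * (1/q) * (u \<bullet> u) + (1/q)\<^sup>2 * (q * (u \<bullet> u))"
    by (intro add_left_mono mult_left_mono le u) auto
  also have "\<dots> = v \<bullet> u - (1/q) * (u \<bullet> u)"
    using q by (simp add: power2_eq_square)
  finally have "u \<bullet> u \<le> q * (v \<bullet> u)" using q by (simp add: field_simps)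
  also have "\<dots> \<le> q * (q * (v \<bullet> v))" 
    using le[OF v] q by (intro mult_left_mono) (auto simp: u_def)
  finally have "(vnorm u)\<^sup>2 \<le> (q * vnorm v)\<^sup>2"
    by (simp add: scalar_prod_self power2_eq_square algebra_simps)
  then show "vnorm (M *\<^sub>v v) \<le> q * vnorm v"
    using q by (auto simp: u_def intro: power2_le_imp_le)
qed

text \<open>The matrices need not commute, so the sum factor of the usual identity is split between
  the two sides. Each summand keeps the factor \<open>M - N\<close>, as the contraction estimate
  requires.\<close>

lemma square_diff_mat:
  fixes M N :: "'a :: ring mat"
  assumes "M \<in> carrier_mat d d" "N \<in> carrier_mat d d"
  shows "M * M - N * N = M * (M - N) + (M - N) * N"
  unfolding mult_minus_distrib_mat[OF assms(1) assms] minus_mult_distrib_mat[OF assms assms(2)]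
  using assms by (intro eq_matI) auto

text \<open>With \<open>B = I - A\<close>, a fixed point \<open>Y = (B + Y\<^sup>2) / 2\<close> satisfies \<open>(I - Y)\<^sup>2 = A\<close>. If the operator norm
  of \<open>B\<close> is at most \<open>q < 1\<close>, this map is a \<open>q\<close>-contraction of the ball of radius \<open>q\<close>.\<close>

fun sqrt_iter :: "real mat \<Rightarrow> nat \<Rightarrow> real mat" where
  "sqrt_iter B 0 = 0\<^sub>m (dim_row B) (dim_row B)"
| "sqrt_iter B (Suc k) = (1/2) \<cdot>\<^sub>m (B + sqrt_iter B k * sqrt_iter B k)"

context
  fixes B :: "real mat" and d :: nat and q :: real
  assumes B: "B \<in> carrier_mat d d" "B\<^sup>T = B" "op_bound d q B" and q: "0 \<le> q" "q < 1"
begin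

lemma sqrt_iter_carrier [simp]: "sqrt_iter B k \<in> carrier_mat d d"
  using B by (induction k) auto

lemma sqrt_iter_dim [simp]: "dim_row (sqrt_iter B k) = d" "dim_col (sqrt_iter B k) = d"
  by (rule carrier_matD[OF sqrt_iter_carrier])+

lemma sqrt_iter_transpose: "(sqrt_iter B k)\<^sup>T = sqrt_iter B k"
proof (induction k)
  case 0
  then show ?case by auto
next
  case (Suc k)
  have "(sqrt_iter B (Suc k))\<^sup>T = (1/2) \<cdot>\<^sub>m (B + sqrt_iter B k * sqrt_iter B k)\<^sup>T"
    by (auto intro!: eq_matI)
  also have "(B + sqrt_iter B k * sqrt_iter B k)\<^sup>T = B\<^sup>T + (sqrt_iter B k * sqrt_iter B k)\<^sup>T"
    using B by (intro transpose_add[of _ d d]) auto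
  finally show ?case
    using Suc B by (simp add: transpose_mult[of _ d d _ d])
qed

lemma op_bound_sqrt_iter: "op_bound d q (sqrt_iter B k)"
proof (induction k)
  case 0
  have "0\<^sub>m d d *\<^sub>v v = 0\<^sub>v d" if "v \<in> carrier_vec d" for v :: "real vec"
    using that by (intro eq_vecI) auto
  then show ?case using B q
    by (auto simp: op_bound_def vnorm_def[of "0\<^sub>v d"] L2_set_def)
next
  case (Suc k)
  have "op_bound d (\<bar>1/2\<bar> * (q + q * q)) (sqrt_iter B (Suc k))"
    unfolding sqrt_iter.simps using Suc B q
    by (intro op_bound_smult op_bound_add op_bound_mult) auto
  \<comment> \<open>The ball of radius \<open>q\<close> is preserved because (q + q^2) / 2 \<le>
    q.\<close>
  then show ?case
    by (rule op_bound_mono) (use q mult_left_le[of q q] in auto)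
qed

text \<open>By \<open>square_diff_mat\<close> the next difference is half of Y D + D Z, where D is
  the current difference and the iterates Y, Z are bounded by \<open>q\<close>. Each step thus gains
  the factor (q + q) / 2.\<close>

lemma op_bound_sqrt_iter_diff: "op_bound d (q ^ k) (sqrt_iter B (Suc k) - sqrt_iter B k)"
proof (induction k)
  case 0
  have "op_bound d (\<bar>1/2\<bar> * q) ((1/2) \<cdot>\<^sub>m B)"
    using B by (intro op_bound_smult)
  moreover have "(1/2) \<cdot>\<^sub>m B = sqrt_iter B (Suc 0) - sqrt_iter B 0"
    using B by (auto intro!: eq_matI)
  ultimately show ?case using q by (auto intro: op_bound_mono)
next
  case (Suc k)
  let ?Y = "sqrt_iter B (Suc k)" and ?Z = "sqrt_iter B k"
  have Y: "?Y \<in> carrier_mat d d" and Z: "?Z \<in> carrier_mat d d"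
    by (rule sqrt_iter_carrier)+
  have D: "?Y - ?Z \<in> carrier_mat d d" by (rule minus_carrier_mat[OF Z])
  have Y_eq: "?Y = (1/2) \<cdot>\<^sub>m (B + ?Z * ?Z)" by (rule sqrt_iter.simps)
  have "sqrt_iter B (Suc (Suc k)) - ?Y
      = (1/2) \<cdot>\<^sub>m (B + ?Y * ?Y) - (1/2) \<cdot>\<^sub>m (B + ?Z * ?Z)"
    by (simp only: sqrt_iter.simps(2)[of B "Suc k"] Y_eq[symmetric])
  also have "\<dots> = (1/2) \<cdot>\<^sub>m (?Y * ?Y - ?Z * ?Z)"
    using B Y Z by (intro eq_matI) (simp_all add: field_simps del: sqrt_iter.simps)
  also have "?Y * ?Y - ?Z * ?Z = ?Y * (?Y - ?Z) + (?Y - ?Z) * ?Z"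
    using Y Z by (rule square_diff_mat)
  finally have "op_bound d (\<bar>1/2\<bar> * (q * q ^ k + q ^ k * q)) (sqrt_iter B (Suc (Suc k)) - ?Y)"
    using op_bound_smult[OF op_bound_add[OF op_bound_mult[OF op_bound_sqrt_iter[of "Suc k"] Suc]
          op_bound_mult[OF Suc op_bound_sqrt_iter[of k]]], of "1/2"] q Y Z D
    by (simp del: sqrt_iter.simps)
  then show ?case by (simp add: mult.commute del: sqrt_iter.simps)
qed

text \<open>Up to the initial term, the entries are partial sums of a telescoping series dominated
  by the geometric series in \<open>q\<close>.\<close>

lemma sqrt_iter_convergent:
  assumes "i < d" "j < d"
  shows "convergent (\<lambda>k. sqrt_iter B k $$ (i, j))"
proof -
  have "summable (\<lambda>k. sqrt_iter B (Suc k) $$ (i, j) - sqrt_iter B k $$ (i, j))"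
  proof (rule summable_comparison_test)
    show "\<exists>N. \<forall>k\<ge>N. norm (sqrt_iter B (Suc k) $$ (i, j) - sqrt_iter B k $$ (i, j)) \<le> q ^ k"
    proof (intro exI allI impI)
      fix k
      have "\<bar>(sqrt_iter B (Suc k) - sqrt_iter B k) $$ (i, j)\<bar> \<le> q ^ k"
        by (rule abs_entry_le_op_bound[OF op_bound_sqrt_iter_diff _ assms])
          (intro minus_carrier_mat sqrt_iter_carrier)
      then show "norm (sqrt_iter B (Suc k) $$ (i, j) - sqrt_iter B k $$ (i, j)) \<le> q ^ k"
        using assms by (simp del: sqrt_iter.simps)
    qed
    show "summable (\<lambda>k. q ^ k)" using q by (simp add: summable_geometric)
  qed
  then have "convergent (\<lambda>n. \<Sum>k<n. sqrt_iter B (Suc k) $$ (i, j) - sqrt_iter B k $$ (i, j))"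
    by (simp add: summable_iff_convergent)
  then have "convergent (\<lambda>n. sqrt_iter B n $$ (i, j) - sqrt_iter B 0 $$ (i, j))"
    unfolding sum_lessThan_telescope[of "\<lambda>k. sqrt_iter B k $$ (i, j)"] .
  then show ?thesis
    by (simp only: convergent_diff_const_right_iff)
qed

definition sqrt_lim :: "real mat" where
  "sqrt_lim = mat d d (\<lambda>(i, j). lim (\<lambda>k. sqrt_iter B k $$ (i, j)))"

lemma sqrt_lim_carrier [simp]: "sqrt_lim \<in> carrier_mat d d"
  by (simp add: sqrt_lim_def)

lemma sqrt_lim_tendsto:
  "i < d \<Longrightarrow> j < d \<Longrightarrow> (\<lambda>k. sqrt_iter B k $$ (i, j)) \<longlonglongrightarrow> sqrt_lim $$ (i, j)"
  using sqrt_iter_convergent[of i j] by (simp add: sqrt_lim_def convergent_LIMSEQ_iff)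

lemma sqrt_lim_transpose: "sqrt_lim\<^sup>T = sqrt_lim"
proof (rule eq_matI)
  fix i j assume "i < dim_row sqrt_lim" "j < dim_col sqrt_lim"
  moreover from this have "sqrt_iter B k $$ (j, i) = sqrt_iter B k $$ (i, j)" for k
    using arg_cong[OF sqrt_iter_transpose[of k], of "\<lambda>M. M $$ (i, j)"] by (simp add: sqrt_lim_def)
  ultimately show "sqrt_lim\<^sup>T $$ (i, j) = sqrt_lim $$ (i, j)"
    by (simp add: sqrt_lim_def)
qed (simp_all add: sqrt_lim_def)

text \<open>Each entry of the right side is a polynomial in finitely many entries, so the recursion
  passes to the limit entrywise.\<close>

lemma sqrt_lim_fixpoint: "sqrt_lim = (1/2) \<cdot>\<^sub>m (B + sqrt_lim * sqrt_lim)"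
proof (rule eq_matI)
  fix i j assume "i < dim_row ((1/2) \<cdot>\<^sub>m (B + sqrt_lim * sqrt_lim))"
    "j < dim_col ((1/2) \<cdot>\<^sub>m (B + sqrt_lim * sqrt_lim))"
  then have ij: "i < d" "j < d" by (auto simp: sqrt_lim_def)
  have entry: "((1/2) \<cdot>\<^sub>m (B + M * M)) $$ (i, j)
      = (1/2) * (B $$ (i, j) + (\<Sum>l<d. M $$ (i, l) * M $$ (l, j)))"
    if "M \<in> carrier_mat d d" for M
    using that B ij by (simp add: scalar_prod_def atLeast0LessThan)
  have "(\<lambda>k. (1/2) * (B $$ (i, j) + (\<Sum>l<d. sqrt_iter B k $$ (i, l) * sqrt_iter B k $$ (l, j))))
      \<longlonglongrightarrow> (1/2) * (B $$ (i, j) + (\<Sum>l<d. sqrt_lim $$ (i, l) * sqrt_lim $$ (l, j)))"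
    using ij by (intro tendsto_intros sqrt_lim_tendsto) auto
  then have "(\<lambda>k. sqrt_iter B (Suc k) $$ (i, j)) \<longlonglongrightarrow> ((1/2) \<cdot>\<^sub>m (B + sqrt_lim * sqrt_lim)) $$ (i, j)"
    unfolding sqrt_iter.simps by (simp only: entry sqrt_iter_carrier sqrt_lim_carrier)
  moreover have "(\<lambda>k. sqrt_iter B (Suc k) $$ (i, j)) \<longlonglongrightarrow> sqrt_lim $$ (i, j)"
    using sqrt_lim_tendsto[OF ij] by (rule LIMSEQ_Suc)
  ultimately show "sqrt_lim $$ (i, j) = ((1/2) \<cdot>\<^sub>m (B + sqrt_lim * sqrt_lim)) $$ (i, j)"
    by (rule LIMSEQ_unique[OF _ _, symmetric])
qed (use B in \<open>auto simp: sqrt_lim_def\<close>)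

text \<open>The bound holds for every iterate by Cauchy-Schwarz and survives the limit. It leaves I
  - Y a margin of 1 - q > 0, from which the strict positivity of the root comes.\<close>

lemma sqrt_lim_form_le:
  assumes v: "v \<in> carrier_vec d"
  shows "v \<bullet> (sqrt_lim *\<^sub>v v) \<le> q * (v \<bullet> v)"
proof -
  have form: "v \<bullet> (M *\<^sub>v v) = (\<Sum>i<d. v $ i * (\<Sum>j<d. M $$ (i, j) * v $ j))"
    if "M \<in> carrier_mat d d" for M
    using that v by (simp add: scalar_prod_def atLeast0LessThan)
  have "(\<lambda>k. \<Sum>i<d. v $ i * (\<Sum>j<d. sqrt_iter B k $$ (i, j) * v $ j))
      \<longlonglongrightarrow> (\<Sum>i<d. v $ i * (\<Sum>j<d. sqrt_lim $$ (i, j) * v $ j))"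
    by (intro tendsto_intros sqrt_lim_tendsto) auto
  then have "(\<lambda>k. v \<bullet> (sqrt_iter B k *\<^sub>v v)) \<longlonglongrightarrow> v \<bullet> (sqrt_lim *\<^sub>v v)"
    by (simp only: form sqrt_iter_carrier sqrt_lim_carrier)
  moreover have "v \<bullet> (sqrt_iter B k *\<^sub>v v) \<le> q * (v \<bullet> v)" for k
  proof -
    have "v \<bullet> (sqrt_iter B k *\<^sub>v v) \<le> vnorm v * vnorm (sqrt_iter B k *\<^sub>v v)"
      using v by (intro order_trans[OF abs_ge_self abs_scalar_prod_le]) simp
    also have "\<dots> \<le> vnorm v * (q * vnorm v)"
      using op_bound_sqrt_iter[of k] v by (intro mult_left_mono) (auto simp: op_bound_def)
    finally show ?thesis by (simp add: scalar_prod_self power2_eq_square algebra_simps)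
  qed
  ultimately show ?thesis by (intro LIMSEQ_le_const2) auto
qed

end


section \<open>Existence and uniqueness of the root\<close>

lemma psd_matD:
  assumes "psd_mat M" "M \<in> carrier_mat d d"
  shows "M\<^sup>T = M" "v \<in> carrier_vec d \<Longrightarrow> 0 \<le> v \<bullet> (M *\<^sub>v v)"
  using assms by (auto simp: psd_mat_def)

text \<open>After scaling, A = S / K lies between I / K and I in the sense of forms, so B = I - A
  has its form between 0 and q = 1 - 1 / K and the iteration applies. The constant \<open>c\<close>
  is recorded because uniqueness needs a strictly positive form; it is sqrt K (1 - q).\<close>

lemma psd_mat_square_root_exists:
  fixes S :: "real mat" and k :: real
  assumes S: "S \<in> carrier_mat d d" "S\<^sup>T = S" and k: "0 < k"
    and lower: "\<And>v. v \<in> carrier_vec d \<Longrightarrow> v \<bullet> v \<le> v \<bullet> (S *\<^sub>v v)"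
    and upper: "\<And>v. v \<in> carrier_vec d \<Longrightarrow> v \<bullet> (S *\<^sub>v v) \<le> k * (v \<bullet> v)"
  obtains C c where "C \<in> carrier_mat d d" "C\<^sup>T = C" "C * C = S" "0 < c"
    "\<And>v. v \<in> carrier_vec d \<Longrightarrow> c * (v \<bullet> v) \<le> v \<bullet> (C *\<^sub>v v)"
proof -
  \<comment> \<open>Taking \<open>k\<close> itself would give q = 0 for k = 1, while
    \<open>op_bound_of_form_bound\<close> divides by \<open>q\<close>.\<close>
  define K where "K = k + 1"
  have K: "1 < K" "k < K" using k by (auto simp: K_def)
  define q where "q = 1 - 1 / K"
  have q: "0 < q" "q < 1" using K by (auto simp: q_def)
  define B where "B = 1\<^sub>m d - (1 / K) \<cdot>\<^sub>m S"
  have B: "B \<in> carrier_mat d d"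
    unfolding B_def using S by (intro minus_carrier_mat smult_carrier_mat)
  have Bt: "B\<^sup>T = B"
  proof (rule eq_matI)
    fix i j assume "i < dim_row B" "j < dim_col B"
    with B have ij: "i < d" "j < d" by auto
    moreover have "S $$ (j, i) = S $$ (i, j)"
      using arg_cong[OF S(2), of "\<lambda>M. M $$ (i, j)"] S(1) ij by simp
    ultimately show "B\<^sup>T $$ (i, j) = B $$ (i, j)" using S(1) by (auto simp: B_def)
  qed (use B in auto)
  have form: "v \<bullet> (B *\<^sub>v v) = v \<bullet> v - (1 / K) * (v \<bullet> (S *\<^sub>v v))" if v: "v \<in> carrier_vec d" for v
  proof -
    have "(1 / K) \<cdot>\<^sub>m S *\<^sub>v v = (1 / K) \<cdot>\<^sub>v (S *\<^sub>v v)"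
      using S v by (intro eq_vecI) auto
    then have "B *\<^sub>v v = v - (1 / K) \<cdot>\<^sub>v (S *\<^sub>v v)"
      using S v by (simp add: B_def minus_mult_distrib_mat_vec[of _ d d])
    then show ?thesis using S v by (simp add: scalar_prod_minus_distrib[of _ d])
  qed
  have op: "op_bound d q B"
  proof (rule op_bound_of_form_bound[OF B Bt q(1)])
    fix v :: "real vec" assume v: "v \<in> carrier_vec d"
    have "v \<bullet> (S *\<^sub>v v) \<le> K * (v \<bullet> v)"
      using upper[OF v] K by (smt (verit) mult_right_mono scalar_prod_self zero_le_power2)
    then show "0 \<le> v \<bullet> (B *\<^sub>v v)"
      using K by (simp add: form[OF v] field_simps)
    have "(1 / K) * (v \<bullet> v) \<le> (1 / K) * (v \<bullet> (S *\<^sub>v v))"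
      using lower[OF v] K by (intro mult_left_mono) auto
    then show "v \<bullet> (B *\<^sub>v v) \<le> q * (v \<bullet> v)"
      by (simp add: form[OF v] q_def algebra_simps)
  qed
  have q0: "0 \<le> q" using q by simp
  define Y where "Y = sqrt_lim B d"
  have Y: "Y \<in> carrier_mat d d" "Y\<^sup>T = Y" "Y = (1/2) \<cdot>\<^sub>m (B + Y * Y)"
    and Yle: "\<And>v. v \<in> carrier_vec d \<Longrightarrow> v \<bullet> (Y *\<^sub>v v) \<le> q * (v \<bullet> v)"
    unfolding Y_def using sqrt_lim_carrier[OF B Bt op q0 q(2)] sqrt_lim_transpose[OF B Bt op q0 q(2)]
      sqrt_lim_fixpoint[OF B Bt op q0 q(2)] sqrt_lim_form_le[OF B Bt op q0 q(2)] by auto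
  define C where "C = sqrt K \<cdot>\<^sub>m (1\<^sub>m d - Y)"
  have C: "C \<in> carrier_mat d d"
    unfolding C_def using Y by (intro smult_carrier_mat minus_carrier_mat)
  have Ct: "C\<^sup>T = C"
  proof (rule eq_matI)
    fix i j assume "i < dim_row C" "j < dim_col C"
    with C have ij: "i < d" "j < d" by auto
    moreover have "Y $$ (j, i) = Y $$ (i, j)"
      using arg_cong[OF Y(2), of "\<lambda>M. M $$ (i, j)"] Y(1) ij by simp
    ultimately show "C\<^sup>T $$ (i, j) = C $$ (i, j)" using Y(1) by (auto simp: C_def)
  qed (use C in auto)
  have "C * C = K \<cdot>\<^sub>m ((1\<^sub>m d - Y) * (1\<^sub>m d - Y))"
    unfolding C_def using Y(1) K
    by (subst mult_smult_assoc_mat[of _ d d _ d]; (subst mult_smult_distrib[of _ d d _ d])?)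
      (auto intro!: eq_matI)
  also have "(1\<^sub>m d - Y) * (1\<^sub>m d - Y) = 1\<^sub>m d - Y - (Y - Y * Y)"
  proof -
    have D: "1\<^sub>m d - Y \<in> carrier_mat d d" by (rule minus_carrier_mat[OF Y(1)])
    show ?thesis
      using Y(1) D by (simp add: minus_mult_distrib_mat[OF one_carrier_mat Y(1) D]
          mult_minus_distrib_mat[OF Y(1) one_carrier_mat Y(1)])
  qed
  \<comment> \<open>The fixed point equation says 2 Y - Y^2 = B.\<close>
  also have "\<dots> = 1\<^sub>m d - B"
  proof (rule eq_matI)
    fix i j assume "i < dim_row (1\<^sub>m d - B)" "j < dim_col (1\<^sub>m d - B)"
    with B have ij: "i < d" "j < d" by auto
    have "Y $$ (i, j) = (1/2) * (B $$ (i, j) + (Y * Y) $$ (i, j))"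
      using arg_cong[OF Y(3), of "\<lambda>M. M $$ (i, j)"] Y(1) B ij by simp
    then show "(1\<^sub>m d - Y - (Y - Y * Y)) $$ (i, j) = (1\<^sub>m d - B) $$ (i, j)"
      using Y(1) B ij by simp
  qed (use Y B in auto)
  also have "K \<cdot>\<^sub>m (1\<^sub>m d - B) = S"
    using S(1) K by (intro eq_matI) (auto simp: B_def)
  finally have CC: "C * C = S" .
  have c: "0 < sqrt K * (1 - q)" using K q by simp
  have le: "sqrt K * (1 - q) * (v \<bullet> v) \<le> v \<bullet> (C *\<^sub>v v)" if v: "v \<in> carrier_vec d" for v
  proof -
    have "C *\<^sub>v v = sqrt K \<cdot>\<^sub>v (v - Y *\<^sub>v v)"
    proof -
      have "C *\<^sub>v v = sqrt K \<cdot>\<^sub>v ((1\<^sub>m d - Y) *\<^sub>v v)"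
        using Y v by (intro eq_vecI) (auto simp: C_def)
      then show ?thesis using Y v by (simp add: minus_mult_distrib_mat_vec[of _ d d])
    qed
    then have "v \<bullet> (C *\<^sub>v v) = sqrt K * (v \<bullet> v - v \<bullet> (Y *\<^sub>v v))"
      using Y v by (simp add: scalar_prod_minus_distrib[of _ d])
    moreover have "sqrt K * ((1 - q) * (v \<bullet> v)) \<le> sqrt K * (v \<bullet> v - v \<bullet> (Y *\<^sub>v v))"
      using Yle[OF v] K by (intro mult_left_mono) (auto simp: algebra_simps)
    ultimately show ?thesis by (simp only: mult.assoc)
  qed
  show thesis by (rule that[OF C Ct CC c le])
qed

text \<open>\<open>D = B - C\<close> satisfies \<open>B D = - D C\<close>. Taking the trace after multiplication by \<open>D\<close>, the left side
  becomes nonnegative and the right side at most \<open>- c\<close> times the squared Frobenius norm of \<open>D\<close>.\<close>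

lemma psd_mat_square_root_unique:
  fixes B C :: "real mat"
  assumes B: "B \<in> carrier_mat d d" "psd_mat B"
    and C: "C \<in> carrier_mat d d" "C\<^sup>T = C" "0 < c"
      "\<And>v. v \<in> carrier_vec d \<Longrightarrow> c * (v \<bullet> v) \<le> v \<bullet> (C *\<^sub>v v)"
    and eq: "B * B = C * C"
  shows "B = C"
proof -
  define D where "D = B - C"
  have D: "D \<in> carrier_mat d d" unfolding D_def by (rule minus_carrier_mat[OF C(1)])
  have Dt: "D\<^sup>T = D"
    unfolding D_def using transpose_minus[OF B(1) C(1)] psd_matD(1)[OF B(2,1)] C(2) by simp
  have BD: "(B * D) $$ (i, j) = - (D * C) $$ (i, j)" if "i < d" "j < d" for i j
  proof -
    have "B * D = B * B - B * C" "D * C = B * C - C * C"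
      unfolding D_def using B C
      by (auto simp: mult_minus_distrib_mat[of _ d d] minus_mult_distrib_mat[of _ d d])
    then show ?thesis using that B C eq by simp
  qed
  \<comment> \<open>Summed over \<open>j\<close>, the right side is the trace of D M D for symmetric
    D. Written through columns, it can be estimated by the forms of \<open>B\<close> and
    \<open>C\<close> one column at a time.\<close>
  have col_form: "col D j \<bullet> (M *\<^sub>v col D j) = (\<Sum>i<d. D $$ (i, j) * (M * D) $$ (i, j))"
    if "M \<in> carrier_mat d d" "j < d" for M j
    using that D by (simp add: scalar_prod_def atLeast0LessThan)
  have D_sym: "D $$ (i, j) = D $$ (j, i)" if "i < d" "j < d" for i j
    using arg_cong[OF Dt, of "\<lambda>M. M $$ (j, i)"] D that by simp
  have C_sym: "C $$ (i, j) = C $$ (j, i)" if "i < d" "j < d" for i j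
    using arg_cong[OF C(2), of "\<lambda>M. M $$ (j, i)"] C(1) that by simp
  have "(D * C) $$ (i, j) = (C * D) $$ (j, i)" if "i < d" "j < d" for i j
  proof -
    have "(D * C) $$ (i, j) = ((D * C)\<^sup>T) $$ (j, i)" using D C that by simp
    also have "(D * C)\<^sup>T = C * D" using transpose_mult[OF D C(1)] Dt C(2) by simp
    finally show ?thesis .
  qed
  then have "(\<Sum>j<d. \<Sum>i<d. D $$ (i, j) * (B * D) $$ (i, j))
      = - (\<Sum>j<d. \<Sum>i<d. D $$ (j, i) * (C * D) $$ (j, i))"
    by (simp add: BD D_sym sum_negf)
  also have "(\<Sum>j<d. \<Sum>i<d. D $$ (j, i) * (C * D) $$ (j, i))
      = (\<Sum>j<d. \<Sum>i<d. D $$ (i, j) * (C * D) $$ (i, j))"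
    by (rule sum.swap)
  finally have "(\<Sum>j<d. col D j \<bullet> (B *\<^sub>v col D j)) = - (\<Sum>j<d. col D j \<bullet> (C *\<^sub>v col D j))"
    using B C by (simp add: col_form)
  moreover have "0 \<le> (\<Sum>j<d. col D j \<bullet> (B *\<^sub>v col D j))"
    using D by (intro sum_nonneg psd_matD(2)[OF B(2,1)]) auto
  moreover have "c * (\<Sum>j<d. col D j \<bullet> col D j) \<le> (\<Sum>j<d. col D j \<bullet> (C *\<^sub>v col D j))"
    unfolding sum_distrib_left using D by (intro sum_mono C(4)) auto
  ultimately have "c * (\<Sum>j<d. col D j \<bullet> col D j) \<le> 0" by simp
  then have le: "(\<Sum>j<d. (vnorm (col D j))\<^sup>2) \<le> 0"
    using C(3) by (simp add: mult_le_0_iff scalar_prod_self)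
  have "vnorm (col D j) = 0" if "j < d" for j
  proof -
    have "(vnorm (col D j))\<^sup>2 \<le> (\<Sum>j<d. (vnorm (col D j))\<^sup>2)"
      using that by (intro member_le_sum) auto
    then have "(vnorm (col D j))\<^sup>2 \<le> 0" using le by (rule order_trans)
    then show ?thesis by simp
  qed
  then have "D $$ (i, j) = 0" if "i < d" "j < d" for i j
    using abs_index_le_vnorm[of i "col D j"] D that by simp
  then show ?thesis
    using B C by (intro eq_matI) (auto simp: D_def)
qed

section \<open>Covariance matrices between the identity and its multiple\<close>

context
  fixes \<Sigma> :: "real mat" and d :: nat and \<kappa> :: real
  assumes \<Sigma>: "\<Sigma> \<in> carrier_mat d d" "1\<^sub>m d \<preceq> \<Sigma>" "\<Sigma> \<preceq> \<kappa> \<cdot>\<^sub>m 1\<^sub>m d"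
begin

text \<open>Symmetry is part of \<open>psd_mat\<close>, and \<Sigma> inherits it from \<Sigma> -
  I.\<close>

lemma loewner_transpose: "\<Sigma>\<^sup>T = \<Sigma>"
proof -
  have "(\<Sigma> - 1\<^sub>m d)\<^sup>T = \<Sigma> - 1\<^sub>m d"
    using \<Sigma> by (intro psd_matD) (auto simp: loewner_le_def)
  then have eq: "\<Sigma>\<^sup>T - 1\<^sub>m d = \<Sigma> - 1\<^sub>m d"
    using transpose_minus[OF \<Sigma>(1) one_carrier_mat] by simp
  show ?thesis
  proof (rule eq_matI)
    fix i j assume "i < dim_row \<Sigma>" "j < dim_col \<Sigma>"
    then show "\<Sigma>\<^sup>T $$ (i, j) = \<Sigma> $$ (i, j)"
      using arg_cong[OF eq, of "\<lambda>M. M $$ (i, j)"] \<Sigma>(1) by auto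
  qed (use \<Sigma> in auto)
qed

lemma loewner_lower:
  assumes v: "v \<in> carrier_vec d"
  shows "v \<bullet> v \<le> v \<bullet> (\<Sigma> *\<^sub>v v)"
proof -
  have "0 \<le> v \<bullet> ((\<Sigma> - 1\<^sub>m d) *\<^sub>v v)"
    using \<Sigma> v by (intro psd_matD(2)) (auto simp: loewner_le_def)
  then show ?thesis
    using \<Sigma> v by (simp add: minus_mult_distrib_mat_vec[of _ d d] scalar_prod_minus_distrib[of _ d])
qed

lemma loewner_upper:
  assumes v: "v \<in> carrier_vec d"
  shows "v \<bullet> (\<Sigma> *\<^sub>v v) \<le> \<kappa> * (v \<bullet> v)"
proof -
  have "0 \<le> v \<bullet> ((\<kappa> \<cdot>\<^sub>m 1\<^sub>m d - \<Sigma>) *\<^sub>v v)"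
    using \<Sigma> v by (intro psd_matD(2)) (auto simp: loewner_le_def)
  moreover have "\<kappa> \<cdot>\<^sub>m 1\<^sub>m d *\<^sub>v v = \<kappa> \<cdot>\<^sub>v v"
    using v by (intro eq_vecI) auto
  ultimately show ?thesis
    using \<Sigma> v by (simp add: minus_mult_distrib_mat_vec[of _ d d] scalar_prod_minus_distrib[of _ d])
qed

text \<open>Tests the order at unit vectors. The diagonal entries are the variances of the
  coordinates, so this places them in the range of the univariate guarantee; for
  \<open>d > 0\<close> it also yields \<open>1 \<le> \<kappa>\<close>.\<close>

lemma loewner_diag:
  assumes j: "j < d"
  shows "1 \<le> \<Sigma> $$ (j, j)" "\<Sigma> $$ (j, j) \<le> \<kappa>"
proof -
  have "unit_vec d j \<bullet> (\<Sigma> *\<^sub>v unit_vec d j) = \<Sigma> $$ (j, j)"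
    using \<Sigma>(1) j by simp
  then show "1 \<le> \<Sigma> $$ (j, j)" "\<Sigma> $$ (j, j) \<le> \<kappa>"
    using loewner_lower[of "unit_vec d j"] loewner_upper[of "unit_vec d j"] j by auto
qed

text \<open>Identifies the definite description with the limit construction; all later facts about
  \<open>mat_sqrt\<close> come through here.\<close>

lemma mat_sqrt_loewner:
  assumes d: "0 < d"
  shows "mat_sqrt \<Sigma> \<in> carrier_mat d d" "(mat_sqrt \<Sigma>)\<^sup>T = mat_sqrt \<Sigma>" "mat_sqrt \<Sigma> * mat_sqrt \<Sigma> = \<Sigma>"
proof -
  have \<kappa>: "0 < \<kappa>" using loewner_diag[OF d] by simp
  obtain C c where C: "C \<in> carrier_mat d d" "C\<^sup>T = C" "C * C = \<Sigma>" "0 < c"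
    "\<And>v. v \<in> carrier_vec d \<Longrightarrow> c * (v \<bullet> v) \<le> v \<bullet> (C *\<^sub>v v)"
    by (rule psd_mat_square_root_exists[OF \<Sigma>(1) loewner_transpose \<kappa> loewner_lower loewner_upper])
      (assumption | (rule that; assumption))+
  have pos: "0 \<le> v \<bullet> (C *\<^sub>v v)" if "v \<in> carrier_vec d" for v
    using C(5)[OF that] C(4) by (smt (verit) mult_nonneg_nonneg scalar_prod_self zero_le_power2)
  have "mat_sqrt \<Sigma> = C"
    unfolding mat_sqrt_def
  proof (rule the_equality)
    show "psd_mat C \<and> C * C = \<Sigma>"
      using C pos by (auto simp: psd_mat_def)
  next
    fix B assume B: "psd_mat B \<and> B * B = \<Sigma>"
    \<comment> \<open>\<open>psd_mat\<close> fixes no dimension, so that of a competing root is read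
      off from its square.\<close>
    have "dim_row B = d" using arg_cong[of _ _ dim_row, OF conjunct2[OF B]] \<Sigma>(1) by simp
    with B have "B \<in> carrier_mat d d" by (auto simp: psd_mat_def)
    with B C show "B = C" by (intro psd_mat_square_root_unique[of B d C c]) auto
  qed
  with C show "mat_sqrt \<Sigma> \<in> carrier_mat d d" "(mat_sqrt \<Sigma>)\<^sup>T = mat_sqrt \<Sigma>" "mat_sqrt \<Sigma> * mat_sqrt \<Sigma> = \<Sigma>"
    by auto
qed

lemma vnorm_mat_sqrt_mult:
  assumes d: "0 < d" and v: "v \<in> carrier_vec d"
  shows "(vnorm (mat_sqrt \<Sigma> *\<^sub>v v))\<^sup>2 = v \<bullet> (\<Sigma> *\<^sub>v v)"
proof -
  note S = mat_sqrt_loewner[OF d]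
  have Sv: "mat_sqrt \<Sigma> *\<^sub>v v \<in> carrier_vec d" using S v by simp
  have "(mat_sqrt \<Sigma> *\<^sub>v v) \<bullet> (mat_sqrt \<Sigma> *\<^sub>v v) = v \<bullet> (mat_sqrt \<Sigma> *\<^sub>v (mat_sqrt \<Sigma> *\<^sub>v v))"
    by (rule symmetric_scalar_prod[OF S(2,1) v Sv])
  also have "mat_sqrt \<Sigma> *\<^sub>v (mat_sqrt \<Sigma> *\<^sub>v v) = \<Sigma> *\<^sub>v v"
    using assoc_mult_mat_vec[OF S(1) S(1) v] S(3) by simp
  finally show ?thesis by (simp add: scalar_prod_self)
qed

text \<open>Since \<Sigma> is at least the identity, the root does not shorten vectors, so its
  kernel is trivial. \<open>norm_wrt\<close> applies \<open>the\<close> to the inverse and is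
  meaningful only once the inverse is known to be \<open>Some T\<close>.\<close>

lemma mat_inverse_mat_sqrt:
  assumes d: "0 < d"
  obtains T where "mat_inverse (mat_sqrt \<Sigma>) = Some T" "T \<in> carrier_mat d d" "mat_sqrt \<Sigma> * T = 1\<^sub>m d"
proof -
  note S = mat_sqrt_loewner[OF d]
  have "v = 0\<^sub>v d" if v: "v \<in> carrier_vec d" and Sv: "mat_sqrt \<Sigma> *\<^sub>v v = 0\<^sub>v d" for v
  proof -
    have "(vnorm v)\<^sup>2 \<le> (vnorm (0\<^sub>v d))\<^sup>2"
      using vnorm_mat_sqrt_mult[OF d v] loewner_lower[OF v] Sv by (simp add: scalar_prod_self)
    then have "vnorm v = 0" by (simp add: vnorm_def[of "0\<^sub>v d"] L2_set_def)
    then show ?thesis using abs_index_le_vnorm[of _ v] v by (intro eq_vecI) auto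
  qed
  then have "Determinant.det (mat_sqrt \<Sigma>) \<noteq> 0"
    using det_0_iff_vec_prod_zero_field[OF S(1)] by blast
  then have "mat_inverse (mat_sqrt \<Sigma>) \<noteq> None"
    using mat_inverse(1)[OF S(1), where b = "()"] det_non_zero_imp_unit[OF S(1), where b = "()"] by blast
  then show thesis using mat_inverse(2)[OF S(1)] that by blast
qed

text \<open>For w = T v, where T inverts the root, |w|^2 \<le> w.(\<Sigma> w), and the right side is
  the squared norm of the root applied to w, which is |v|^2.\<close>

lemma norm_wrt_le_L2_set:
  assumes d: "0 < d"
  shows "norm_wrt d \<Sigma> v \<le> L2_set v {..<d}"
proof -
  obtain T where T: "mat_inverse (mat_sqrt \<Sigma>) = Some T" "T \<in> carrier_mat d d" "mat_sqrt \<Sigma> * T = 1\<^sub>m d"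
    by (rule mat_inverse_mat_sqrt[OF d])
  have Tv: "T *\<^sub>v vec d v \<in> carrier_vec d" using T by simp
  have "mat_sqrt \<Sigma> *\<^sub>v (T *\<^sub>v vec d v) = vec d v"
    using assoc_mult_mat_vec[OF mat_sqrt_loewner(1)[OF d] T(2), of "vec d v"] T(3) by simp
  then have "(vnorm (T *\<^sub>v vec d v))\<^sup>2 \<le> (vnorm (vec d v))\<^sup>2"
    using vnorm_mat_sqrt_mult[OF d Tv] loewner_lower[OF Tv] by (simp add: scalar_prod_self)
  then have "vnorm (T *\<^sub>v vec d v) \<le> vnorm (vec d v)"
    by (rule power2_le_imp_le) simp
  moreover have "vnorm (T *\<^sub>v vec d v) = norm_wrt d \<Sigma> v"
    using T by (simp add: vnorm_def norm_wrt_def)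
  moreover have "vnorm (vec d v) = L2_set v {..<d}"
    by (simp add: vnorm_def L2_set_def)
  ultimately show ?thesis by simp
qed

lemma borel_measurable_norm_wrt:
  assumes d: "0 < d"
  shows "(\<lambda>m. norm_wrt d \<Sigma> (\<lambda>j. \<mu> j - m j)) \<in> borel_measurable (Rvec d)"
proof -
  obtain T where T: "mat_inverse (mat_sqrt \<Sigma>) = Some T" "T \<in> carrier_mat d d"
    using mat_inverse_mat_sqrt[OF d] by blast
  \<comment> \<open>With the inverse fixed, the norm is an explicit finite expression in the
    coordinates; this makes the accuracy event measurable.\<close>
  have "norm_wrt d \<Sigma> v = sqrt (\<Sum>i<d. (\<Sum>k<d. T $$ (i, k) * v k)\<^sup>2)" for v
    using T by (simp add: norm_wrt_def L2_set_def scalar_prod_def atLeast0LessThan)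
  then show ?thesis by simp
qed

end

subsection \<open>Marginals of the output\<close>

text \<open>The preimage of a box under a coordinatewise map is a box, and boxes determine the
  product law.\<close>

lemma distr_PiM_map:
  assumes P: "\<And>i. i \<in> I \<Longrightarrow> prob_space (P i)" and fin: "finite I"
    and f: "\<And>i. i \<in> I \<Longrightarrow> f i \<in> P i \<rightarrow>\<^sub>M N i"
  shows "distr (PiM I P) (PiM I N) (\<lambda>x. \<lambda>i\<in>I. f i (x i)) = PiM I (\<lambda>i. distr (P i) (N i) (f i))"
proof -
  define L where "L i = (if i \<in> I then distr (P i) (N i) (f i) else return (count_space UNIV) undefined)" for i
  interpret L: product_prob_space L
    by (rule product_prob_spaceI)
      (auto simp: L_def prob_space_return intro: prob_space.prob_space_distr P f)
  define P' where "P' i = (if i \<in> I then P i else return (count_space UNIV) undefined)" for i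
  interpret P': product_prob_space P'
    by (rule product_prob_spaceI) (auto simp: P'_def prob_space_return intro: P)
  have P_eq: "PiM I P = PiM I P'" by (rule PiM_cong) (auto simp: P'_def)
  have L_eq: "PiM I (\<lambda>i. distr (P i) (N i) (f i)) = PiM I L" by (rule PiM_cong) (auto simp: L_def)
  have meas: "(\<lambda>x. \<lambda>i\<in>I. f i (x i)) \<in> PiM I P \<rightarrow>\<^sub>M PiM I N"
    using f by (intro measurable_restrict measurable_compose[OF measurable_component_singleton]) auto
  have "distr (PiM I P) (PiM I N) (\<lambda>x. \<lambda>i\<in>I. f i (x i)) = PiM I L"
  proof (rule L.PiM_eqI[OF fin])
    show "sets (distr (PiM I P) (PiM I N) (\<lambda>x. \<lambda>i\<in>I. f i (x i))) = sets (PiM I L)"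
      unfolding sets_distr by (rule sets_PiM_cong) (auto simp: L_def)
  next
    fix A assume "\<And>i. i \<in> I \<Longrightarrow> A i \<in> sets (L i)"
    then have A: "A i \<in> sets (N i)" if "i \<in> I" for i using that by (auto simp: L_def)
    have "emeasure (distr (PiM I P) (PiM I N) (\<lambda>x. \<lambda>i\<in>I. f i (x i))) (Pi\<^sub>E I A)
       = emeasure (PiM I P) ((\<lambda>x. \<lambda>i\<in>I. f i (x i)) -` Pi\<^sub>E I A \<inter> space (PiM I P))"
      using A fin meas by (intro emeasure_distr sets_PiM_I_finite)
    also have "(\<lambda>x. \<lambda>i\<in>I. f i (x i)) -` Pi\<^sub>E I A \<inter> space (PiM I P) = (\<Pi>\<^sub>E i\<in>I. f i -` A i \<inter> space (P i))"
      by (auto simp: space_PiM PiE_iff)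
    also have "emeasure (PiM I P) \<dots> = (\<Prod>i\<in>I. emeasure (P' i) (f i -` A i \<inter> space (P i)))"
      unfolding P_eq using f A fin
      by (intro P'.emeasure_PiM) (auto simp: P'_def intro: measurable_sets)
    also have "\<dots> = (\<Prod>i\<in>I. emeasure (L i) (A i))"
      using f A by (intro prod.cong) (auto simp: P'_def L_def emeasure_distr)
    finally show "emeasure (distr (PiM I P) (PiM I N) (\<lambda>x. \<lambda>i\<in>I. f i (x i))) (Pi\<^sub>E I A)
        = (\<Prod>i\<in>I. emeasure (L i) (A i))" .
  qed
  then show ?thesis unfolding L_eq .
qed

lemma distr_linear_std_normal:
  fixes a :: "nat \<Rightarrow> real"
  assumes pos: "0 < (\<Sum>k<d. (a k)\<^sup>2)"
  shows "distr (\<Pi>\<^sub>M j\<in>{..<d}. density lborel std_normal_density) borel (\<lambda>z. \<mu> + (\<Sum>k<d. a k * z k))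
    = density lborel (normal_density \<mu> (sqrt (\<Sum>k<d. (a k)\<^sup>2)))"
proof -
  let ?N = "density lborel std_normal_density"
  let ?M = "\<Pi>\<^sub>M j\<in>{..<d}. ?N"
  have N: "prob_space ?N" by (rule prob_space_normal_density) simp
  interpret M: prob_space ?M by (rule prob_space_PiM) (rule N)
  \<comment> \<open>A normal density needs positive standard deviation, so coordinates with zero
    coefficient are removed before independent normals are added.\<close>
  define J where "J = {k\<in>{..<d}. a k \<noteq> 0}"
  have J: "finite J" "J \<subseteq> {..<d}" by (auto simp: J_def)
  have sum_J: "(\<Sum>k<d. (a k)\<^sup>2) = (\<Sum>k\<in>J. (a k)\<^sup>2)"
    unfolding J_def by (intro sum.mono_neutral_right) auto
  have "J \<noteq> {}" using pos sum_J by auto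
  have comp: "distr ?M ?N (\<lambda>z. z k) = ?N" if "k < d" for k
    using that by (intro distr_PiM_component N) auto
  have meas: "(\<lambda>z. z k) \<in> ?M \<rightarrow>\<^sub>M borel" if "k < d" for k
    using measurable_component_singleton[of k "{..<d}" "\<lambda>_. ?N"] that by simp
  have Z: "distributed ?M lborel (\<lambda>z. z k) std_normal_density" if "k < d" for k
    unfolding distributed_def using comp[OF that] meas[OF that]
    by (auto cong: distr_cong)
  have aZ: "distributed ?M lborel (\<lambda>z. a k * z k) (normal_density 0 \<bar>a k\<bar>)" if "k \<in> J" for k
    using M.normal_density_affine[OF Z[of k], of "a k" 0] that by (auto simp: J_def)
  have "M.indep_vars (\<lambda>_. borel) (\<lambda>k z. z k) {..<d}"
  proof (subst M.indep_vars_iff_distr_eq_PiM')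
    show "{..<d} \<noteq> {}" using \<open>J \<noteq> {}\<close> J by auto
    \<comment> \<open>The identity has the product as its law, so the joint law of the coordinates
      is the product of their marginals, which is independence.\<close>
    have "distr ?M (\<Pi>\<^sub>M k\<in>{..<d}. borel) (\<lambda>z. \<lambda>k\<in>{..<d}. z k) = distr ?M ?M (\<lambda>z. z)"
      by (intro distr_cong sets_PiM_cong) (auto simp: space_PiM)
    also have "\<dots> = (\<Pi>\<^sub>M k\<in>{..<d}. distr ?M borel (\<lambda>z. z k))"
      using comp by (subst distr_id2) (auto intro!: PiM_cong simp: cong: distr_cong)
    finally show "distr ?M (\<Pi>\<^sub>M k\<in>{..<d}. borel) (\<lambda>z. \<lambda>k\<in>{..<d}. z k)
        = (\<Pi>\<^sub>M k\<in>{..<d}. distr ?M borel (\<lambda>z. z k))" .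
  qed (auto intro: meas)
  then have "M.indep_vars (\<lambda>_. borel) (\<lambda>k z. z k) J"
    using J(2) by (rule M.indep_vars_subset)
  then have "M.indep_vars (\<lambda>_. borel) (\<lambda>k z. a k * z k) J"
    by (rule M.indep_vars_compose2) auto
  then have "distributed ?M lborel (\<lambda>z. \<Sum>k\<in>J. a k * z k)
      (normal_density (\<Sum>k\<in>J. 0) (sqrt (\<Sum>k\<in>J. \<bar>a k\<bar>\<^sup>2)))"
    using aZ J \<open>J \<noteq> {}\<close> by (intro M.sum_indep_normal) (auto simp: J_def)
  moreover have "(\<Sum>k\<in>J. a k * z k) = (\<Sum>k<d. a k * z k)" for z :: "nat \<Rightarrow> real"
    unfolding J_def by (intro sum.mono_neutral_left) auto
  ultimately have "distributed ?M lborel (\<lambda>z. \<Sum>k<d. a k * z k)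
      (normal_density 0 (sqrt (\<Sum>k<d. (a k)\<^sup>2)))"
    by (simp add: sum_J)
  then have "distributed ?M lborel (\<lambda>z. \<mu> + 1 * (\<Sum>k<d. a k * z k))
      (normal_density (\<mu> + 1 * 0) (\<bar>1\<bar> * sqrt (\<Sum>k<d. (a k)\<^sup>2)))"
    by (rule M.normal_density_affine) (use pos in auto)
  then show ?thesis
    by (simp add: distributed_def cong: distr_cong)
qed

text \<open>Given the data, the output is a product law whose marginal at \<open>j\<close> depends
  on column \<open>j\<close> alone, and column \<open>j\<close> of an i.i.d. sample from
  \<open>P\<close> is an i.i.d. sample from the marginal of \<open>P\<close>. No independence
  between different columns enters.\<close>

lemma distr_output_NaivePME:
  fixes KVMean d \<rho> \<alpha> \<beta> R \<kappa>
  defines "K \<equiv> KVMean (\<rho> / real d) (\<alpha> / (\<kappa> * sqrt (real d))) (\<beta> / real d) R \<kappa>"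
  assumes K: "randomized_algorithm borel borel K"
    and P: "prob_space P" "sets P = sets (Rvec d)" and j: "j < d"
  shows "distr (output_on_samples (NaivePME KVMean d \<rho> \<alpha> \<beta> R \<kappa>) n P) borel (\<lambda>m. m j)
    = output_on_samples K n (distr P borel (\<lambda>x. x j))"
proof -
  let ?A = "NaivePME KVMean d \<rho> \<alpha> \<beta> R \<kappa>"
  let ?col = "\<lambda>X j. \<lambda>i\<in>{..<n}. X i j"
  let ?S = "\<Pi>\<^sub>M i\<in>{..<n}. P"
  have A_eq: "?A n X = (\<Pi>\<^sub>M j\<in>{..<d}. K n (?col X j))" for X
    by (simp add: NaivePME_def K_def Let_def)
  interpret S: prob_space ?S by (rule prob_space_PiM) (rule P)
  have S_sets: "sets ?S = sets (\<Pi>\<^sub>M i\<in>{..<n}. Rvec d)"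
    by (rule sets_PiM_cong) (auto simp: P)
  have Kn: "K n \<in> (\<Pi>\<^sub>M i\<in>{..<n}. borel) \<rightarrow>\<^sub>M prob_algebra borel"
    using K by (simp add: randomized_algorithm_def)
  have coord: "(\<lambda>x. x j) \<in> P \<rightarrow>\<^sub>M borel" if "j < d" for j
    using that by (simp add: measurable_cong_sets[OF P(2) refl])
  have col: "(\<lambda>X. ?col X j) \<in> ?S \<rightarrow>\<^sub>M (\<Pi>\<^sub>M i\<in>{..<n}. borel)" if "j < d" for j
    using coord[OF that] by (intro measurable_restrict measurable_compose[OF measurable_component_singleton])
  have Kcol: "(\<lambda>X. K n (?col X j)) \<in> ?S \<rightarrow>\<^sub>M prob_algebra borel" if "j < d" for j
    using col[OF that] Kn by (rule measurable_compose)
  have "(\<lambda>X. \<Pi>\<^sub>M j\<in>{..<d}. K n (?col X j)) \<in> ?S \<rightarrow>\<^sub>M prob_algebra (Rvec d)"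
    by (intro measurable_PiM_kernel Kcol) auto
  then have A: "?A n \<in> ?S \<rightarrow>\<^sub>M prob_algebra (Rvec d)"
    by (simp only: A_eq[symmetric])
  have Kx: "prob_space (K n (?col X j))" "sets (K n (?col X j)) = sets borel" for X j
    using measurable_space[OF Kn, of "?col X j"] by (auto simp: space_prob_algebra space_PiM)
  have "distr (?S \<bind> ?A n) borel (\<lambda>m. m j) = ?S \<bind> (\<lambda>X. distr (?A n X) borel (\<lambda>m. m j))"
    using j by (intro distr_bind[OF measurable_prob_algebraD[OF A] S.not_empty]) auto
  also have "\<dots> = ?S \<bind> (\<lambda>X. K n (?col X j))"
  proof (rule bind_cong[OF refl])
    fix X
    \<comment> \<open>\<open>distr\<close> depends on its target only through the measurable sets;
      naming the factor as target gives the form of \<open>distr_PiM_component\<close>.\<close>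
    have "distr (?A n X) borel (\<lambda>m. m j) = distr (?A n X) (K n (?col X j)) (\<lambda>m. m j)"
      by (rule distr_cong) (auto simp: Kx)
    also have "\<dots> = K n (?col X j)"
      unfolding A_eq using j by (intro distr_PiM_component Kx) auto
    finally show "distr (?A n X) borel (\<lambda>m. m j) = K n (?col X j)" .
  qed
  also have "\<dots> = distr ?S (\<Pi>\<^sub>M i\<in>{..<n}. borel) (\<lambda>X. ?col X j) \<bind> K n"
    by (rule bind_distr[OF col[OF j] measurable_prob_algebraD[OF Kn] S.not_empty, symmetric])
  also have "distr ?S (\<Pi>\<^sub>M i\<in>{..<n}. borel) (\<lambda>X. ?col X j) = (\<Pi>\<^sub>M i\<in>{..<n}. distr P borel (\<lambda>x. x j))"
    using coord[OF j] by (intro distr_PiM_map P) auto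
  finally show ?thesis by (simp add: output_on_samples_def)
qed


lemma measurable_affine_Rvec:
  fixes S :: "real mat"
  assumes S: "S \<in> carrier_mat d d"
  shows "(\<lambda>z. \<lambda>i\<in>{..<d}. \<mu> i + (S *\<^sub>v vec d z) $ i)
    \<in> (\<Pi>\<^sub>M j\<in>{..<d}. density lborel std_normal_density) \<rightarrow>\<^sub>M Rvec d"
    (is "_ \<in> ?Z \<rightarrow>\<^sub>M _")
proof (rule measurable_restrict)
  fix i assume i: "i \<in> {..<d}"
  have coord: "(\<lambda>z. z k) \<in> borel_measurable ?Z" if "k < d" for k
    using measurable_component_singleton[of k "{..<d}" "\<lambda>_. density lborel std_normal_density"] that
    by simp
  have "(\<lambda>z. \<mu> i + (\<Sum>k<d. S $$ (i, k) * z k)) \<in> borel_measurable ?Z"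
    using coord by (intro borel_measurable_add borel_measurable_sum borel_measurable_times) auto
  with i S show "(\<lambda>z. \<mu> i + (S *\<^sub>v vec d z) $ i) \<in> borel_measurable ?Z"
    by (simp add: scalar_prod_def atLeast0LessThan)
qed

text \<open>The coordinate is a linear form in standard normals with coefficients from row
  \<open>j\<close> of the root S. Its variance is the squared length of that row, which by symmetry
  is the diagonal entry of S S = \<Sigma>.\<close>

lemma distr_mv_gaussian_component:
  assumes \<Sigma>: "\<Sigma> \<in> carrier_mat d d" "1\<^sub>m d \<preceq> \<Sigma>" "\<Sigma> \<preceq> \<kappa> \<cdot>\<^sub>m 1\<^sub>m d" and j: "j < d"
  shows "distr (mv_gaussian d \<mu> \<Sigma>) borel (\<lambda>x. x j)
    = density lborel (normal_density (\<mu> j) (sqrt (\<Sigma> $$ (j, j))))"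
proof -
  let ?Z = "\<Pi>\<^sub>M j\<in>{..<d}. density lborel std_normal_density"
  define S where "S = mat_sqrt \<Sigma>"
  have S: "S \<in> carrier_mat d d" "S\<^sup>T = S" "S * S = \<Sigma>"
    using mat_sqrt_loewner[OF \<Sigma>] j by (auto simp: S_def)
  have index: "(S *\<^sub>v vec d z) $ i = (\<Sum>k<d. S $$ (i, k) * z k)" if "i < d" for i z
    using S that by (simp add: scalar_prod_def atLeast0LessThan)
  have "S $$ (k, j) = S $$ (j, k)" if "k < d" for k
    using arg_cong[OF S(2), of "\<lambda>M. M $$ (j, k)"] S(1) j that by simp
  then have "(\<Sum>k<d. (S $$ (j, k))\<^sup>2) = (S * S) $$ (j, j)"
    using S(1) j by (simp add: scalar_prod_def atLeast0LessThan power2_eq_square)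
  then have sum_eq: "(\<Sum>k<d. (S $$ (j, k))\<^sup>2) = \<Sigma> $$ (j, j)"
    by (simp add: S(3))
  have "(\<lambda>z. \<lambda>i\<in>{..<d}. \<mu> i + (S *\<^sub>v vec d z) $ i) \<in> ?Z \<rightarrow>\<^sub>M Rvec d"
    using S(1) by (rule measurable_affine_Rvec)
  then have "distr (mv_gaussian d \<mu> \<Sigma>) borel (\<lambda>x. x j)
      = distr ?Z borel ((\<lambda>x. x j) \<circ> (\<lambda>z. \<lambda>i\<in>{..<d}. \<mu> i + (S *\<^sub>v vec d z) $ i))"
    unfolding mv_gaussian_def S_def[symmetric] using j by (intro distr_distr) auto
  also have "\<dots> = distr ?Z borel (\<lambda>z. \<mu> j + (\<Sum>k<d. S $$ (j, k) * z k))"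
    using j by (intro distr_cong) (auto simp: index)
  also have "\<dots> = density lborel (normal_density (\<mu> j) (sqrt (\<Sigma> $$ (j, j))))"
    using distr_linear_std_normal[where a = "\<lambda>k. S $$ (j, k)" and d = d and \<mu> = "\<mu> j"]
      loewner_diag(1)[OF \<Sigma> j] by (simp add: sum_eq)
  finally show ?thesis .
qed

lemma prob_space_mv_gaussian:
  assumes \<Sigma>: "\<Sigma> \<in> carrier_mat d d" "1\<^sub>m d \<preceq> \<Sigma>" "\<Sigma> \<preceq> \<kappa> \<cdot>\<^sub>m 1\<^sub>m d" and d: "0 < d"
  shows "prob_space (mv_gaussian d \<mu> \<Sigma>)"
proof -
  let ?Z = "\<Pi>\<^sub>M j\<in>{..<d}. density lborel std_normal_density"
  define S where "S = mat_sqrt \<Sigma>"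
  have S: "S \<in> carrier_mat d d"
    using mat_sqrt_loewner[OF \<Sigma> d] by (auto simp: S_def)
  have "(\<lambda>z. \<lambda>i\<in>{..<d}. \<mu> i + (S *\<^sub>v vec d z) $ i) \<in> ?Z \<rightarrow>\<^sub>M Rvec d"
    using S by (rule measurable_affine_Rvec)
  moreover have "prob_space ?Z"
    by (intro prob_space_PiM prob_space_normal_density) simp
  ultimately show ?thesis
    unfolding mv_gaussian_def S_def by (intro prob_space.prob_space_distr)
qed

section \<open>Accuracy in all coordinates at once\<close>

lemma output_on_samples_prob_algebra:
  assumes "randomized_algorithm \<X> \<Y> M" "prob_space P" "sets P = sets \<X>"
  shows "prob_space (output_on_samples M n P)" "sets (output_on_samples M n P) = sets \<Y>"
proof -
  have "(\<Pi>\<^sub>M i\<in>{..<n}. P) \<in> space (prob_algebra (\<Pi>\<^sub>M i\<in>{..<n}. \<X>))"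
    using assms by (auto simp: space_prob_algebra intro!: prob_space_PiM sets_PiM_cong)
  moreover have "M n \<in> (\<Pi>\<^sub>M i\<in>{..<n}. \<X>) \<rightarrow>\<^sub>M prob_algebra \<Y>"
    using assms by (simp add: randomized_algorithm_def)
  ultimately show "prob_space (output_on_samples M n P)" "sets (output_on_samples M n P) = sets \<Y>"
    unfolding output_on_samples_def by (rule prob_space_bind' sets_bind')+
qed

text \<open>The univariate error \<alpha>' \<kappa> equals \<alpha> / sqrt d, so \<open>d\<close>
  squared errors sum to at most \<alpha>^2, while \<open>d\<close> failure probabilities \<beta> / d
  add up to \<beta>.\<close>

lemma NaivePME_accurate:
  fixes KVMean d \<rho> \<alpha> \<beta> R \<kappa>
  defines "K \<equiv> KVMean (\<rho> / real d) (\<alpha> / (\<kappa> * sqrt (real d))) (\<beta> / real d) R \<kappa>"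
  assumes K: "randomized_algorithm borel borel K"
    and A: "randomized_algorithm (Rvec d) (Rvec d) (NaivePME KVMean d \<rho> \<alpha> \<beta> R \<kappa>)"
    and d: "0 < d" and \<alpha>: "0 < \<alpha>"
    and acc: "\<And>\<mu> \<sigma>. \<bar>\<mu>\<bar> \<le> R \<Longrightarrow> \<sigma> > 0 \<Longrightarrow> 1 \<le> \<sigma>\<^sup>2 \<Longrightarrow> \<sigma>\<^sup>2 \<le> \<kappa> \<Longrightarrow>
      \<P>(m in output_on_samples K n (density lborel (normal_density \<mu> \<sigma>)).
        \<bar>\<mu> - m\<bar> \<le> \<alpha> / (\<kappa> * sqrt (real d)) * \<kappa>) \<ge> 1 - \<beta> / real d"
    and \<mu>: "L2_set \<mu> {..<d} \<le> R"
    and \<Sigma>: "\<Sigma> \<in> carrier_mat d d" "1\<^sub>m d \<preceq> \<Sigma>" "\<Sigma> \<preceq> \<kappa> \<cdot>\<^sub>m 1\<^sub>m d"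
  shows "\<P>(m in output_on_samples (NaivePME KVMean d \<rho> \<alpha> \<beta> R \<kappa>) n (mv_gaussian d \<mu> \<Sigma>).
    norm_wrt d \<Sigma> (\<lambda>j. \<mu> j - m j) \<le> \<alpha>) \<ge> 1 - \<beta>"
proof -
  define P where "P = mv_gaussian d \<mu> \<Sigma>"
  have P: "prob_space P" "sets P = sets (Rvec d)"
    unfolding P_def by (rule prob_space_mv_gaussian[OF \<Sigma> d], simp add: mv_gaussian_def)
  define M where "M = output_on_samples (NaivePME KVMean d \<rho> \<alpha> \<beta> R \<kappa>) n P"
  interpret M: prob_space M
    unfolding M_def by (rule output_on_samples_prob_algebra[OF A P])
  have M_sets: "sets M = sets (Rvec d)"
    unfolding M_def by (rule output_on_samples_prob_algebra[OF A P])
  have coord: "(\<lambda>m. m j) \<in> borel_measurable M" if "j < d" for j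
    using that by (simp add: measurable_cong_sets[OF M_sets refl])
  have \<kappa>: "1 \<le> \<kappa>" using loewner_diag[OF \<Sigma> d] by simp
  define \<delta> where "\<delta> = \<alpha> / sqrt (real d)"
  have \<delta>: "\<alpha> / (\<kappa> * sqrt (real d)) * \<kappa> = \<delta>" using \<kappa> by (simp add: \<delta>_def)
  define bad where "bad j = {m \<in> space M. \<not> \<bar>\<mu> j - m j\<bar> \<le> \<delta>}" for j
  have bad_sets: "bad j \<in> M.events" if "j < d" for j
    unfolding bad_def using coord[OF that] by measurable
  have bad_prob: "M.prob (bad j) \<le> \<beta> / real d" if j: "j < d" for j
  proof -
    let ?good = "{m \<in> space M. \<bar>\<mu> j - m j\<bar> \<le> \<delta>}"
    have "\<bar>\<mu> j\<bar> \<le> L2_set \<mu> {..<d}"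
      using member_le_L2_set[of "{..<d}" j "\<lambda>i. \<bar>\<mu> i\<bar>"] j by (simp add: L2_set_def)
    then have "1 - \<beta> / real d \<le> \<P>(m in output_on_samples K n
        (density lborel (normal_density (\<mu> j) (sqrt (\<Sigma> $$ (j, j))))). \<bar>\<mu> j - m\<bar> \<le> \<delta>)"
      using acc[of "\<mu> j" "sqrt (\<Sigma> $$ (j, j))"] \<mu> loewner_diag[OF \<Sigma> j] unfolding \<delta> by simp
    also have "output_on_samples K n (density lborel (normal_density (\<mu> j) (sqrt (\<Sigma> $$ (j, j)))))
        = distr M borel (\<lambda>m. m j)"
      using distr_output_NaivePME[where KVMean = KVMean and d = d and \<rho> = \<rho> and \<alpha> = \<alpha> and \<beta> = \<beta>
            and R = R and \<kappa> = \<kappa> and n = n, OF K[unfolded K_def] P j] distr_mv_gaussian_component[OF \<Sigma> j]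
      by (simp add: M_def K_def P_def)
    also have "\<P>(m in distr M borel (\<lambda>m. m j). \<bar>\<mu> j - m\<bar> \<le> \<delta>) = M.prob ?good"
      using coord[OF j] by (subst measure_distr) (auto intro!: arg_cong[where f = M.prob])
    also have "bad j = space M - ?good" by (auto simp: bad_def)
    then have "M.prob ?good = 1 - M.prob (bad j)"
      using M.prob_compl[of ?good] coord[OF j] by simp
    finally show ?thesis by simp
  qed
  have "M.prob (\<Union>j\<in>{..<d}. bad j) \<le> (\<Sum>j<d. M.prob (bad j))"
    using bad_sets by (intro M.finite_measure_subadditive_finite) auto
  also have "\<dots> \<le> (\<Sum>j<d. \<beta> / real d)"
    by (intro sum_mono bad_prob) auto
  also have "\<dots> = \<beta>" using d by simp
  finally have union: "M.prob (\<Union>j\<in>{..<d}. bad j) \<le> \<beta>" .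
  have "1 - M.prob (\<Union>j\<in>{..<d}. bad j) = M.prob (space M - (\<Union>j\<in>{..<d}. bad j))"
    using bad_sets by (intro M.prob_compl[symmetric]) auto
  also have "\<dots> \<le> \<P>(m in M. norm_wrt d \<Sigma> (\<lambda>j. \<mu> j - m j) \<le> \<alpha>)"
  proof (rule M.finite_measure_mono)
    have "(\<lambda>m. norm_wrt d \<Sigma> (\<lambda>j. \<mu> j - m j)) \<in> borel_measurable M"
      using borel_measurable_norm_wrt[OF \<Sigma> d] by (simp add: measurable_cong_sets[OF M_sets refl])
    then show "{m \<in> space M. norm_wrt d \<Sigma> (\<lambda>j. \<mu> j - m j) \<le> \<alpha>} \<in> M.events"
      by measurable
    show "space M - (\<Union>j\<in>{..<d}. bad j) \<subseteq> {m \<in> space M. norm_wrt d \<Sigma> (\<lambda>j. \<mu> j - m j) \<le> \<alpha>}"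
    proof safe
      fix m assume m: "m \<in> space M" "m \<notin> (\<Union>j\<in>{..<d}. bad j)"
      have "(\<Sum>j<d. (\<mu> j - m j)\<^sup>2) \<le> (\<Sum>j<d. \<delta>\<^sup>2)"
      proof (rule sum_mono)
        fix j assume "j \<in> {..<d}"
        with m have "\<bar>\<mu> j - m j\<bar> \<le> \<delta>" by (auto simp: bad_def)
        then show "(\<mu> j - m j)\<^sup>2 \<le> \<delta>\<^sup>2"
          using power_mono[of "\<bar>\<mu> j - m j\<bar>" \<delta> 2] by simp
      qed
      also have "\<dots> = \<alpha>\<^sup>2" using d by (simp add: \<delta>_def power_divide)
      finally have "L2_set (\<lambda>j. \<mu> j - m j) {..<d} \<le> \<alpha>"
        unfolding L2_set_def using \<alpha> by (intro real_le_lsqrt) (auto intro: sum_nonneg)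
      then show "norm_wrt d \<Sigma> (\<lambda>j. \<mu> j - m j) \<le> \<alpha>"
        using norm_wrt_le_L2_set[OF \<Sigma> d] by (rule order_trans[rotated])
    qed
  qed
  finally show ?thesis using union by (simp add: M_def P_def)
qed

subsection \<open>Sample complexity\<close>

lemma lg_ge_1: "1 \<le> lg x"
  by (simp add: lg_def)

lemma lg_mono: "0 < x \<Longrightarrow> x \<le> y \<Longrightarrow> lg x \<le> lg y"
  unfolding lg_def by (intro max.mono) auto

text \<open>The substitution of \<open>\<rho>'\<close>, \<open>\<alpha>'\<close>, \<open>\<beta>'\<close> puts \<open>D\<^bsup>5/2\<^esup>\<close> instead of \<open>D\<close> into the logarithm. With
  \<open>Y = \<kappa> L / (\<alpha> \<beta> \<rho>)\<close>, this costs a factor \<open>5/2\<close> if \<open>Y \<ge> 1\<close>. Otherwise \<open>\<rho> \<ge> 1 / A\<close>, and the first term of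
  the bound absorbs the excess.\<close>

lemma NaivePME_lg_bound:
  fixes A D \<alpha> \<beta> \<rho> \<kappa> L :: real
  assumes "0 < \<alpha>" "\<alpha> \<le> A" "0 < \<beta>" "\<beta> \<le> 1" "0 < \<rho>" "1 \<le> \<kappa>" "1 \<le> D" "1 \<le> L"
  shows "\<kappa> * D * lg (\<kappa> * (D\<^sup>2 * sqrt D) * L / (\<alpha> * \<beta> * \<rho>)) / (\<alpha> * sqrt \<rho>)
    \<le> 5 / 2 * (\<kappa> * D * lg (\<kappa> * D * L / (\<alpha> * \<beta> * \<rho>)) / (\<alpha> * sqrt \<rho>))
      + 5 / 2 * (A * sqrt A) * (\<kappa>\<^sup>2 * D * lg (D / \<beta>) / \<alpha>\<^sup>2)"
proof -
  define Y where "Y = \<kappa> * L / (\<alpha> * \<beta> * \<rho>)"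
  have Y: "0 < Y" using assms by (simp add: Y_def)
  have A: "0 < A" using assms by simp
  define F where "F = \<kappa> * D / (\<alpha> * sqrt \<rho>)"
  have F: "0 \<le> F" using assms by (simp add: F_def)
  have T1: "0 \<le> 5 / 2 * (A * sqrt A) * (\<kappa>\<^sup>2 * D * lg (D / \<beta>) / \<alpha>\<^sup>2)"
    using assms A lg_ge_1[of "D / \<beta>"] by (intro mult_nonneg_nonneg divide_nonneg_nonneg) auto
  have T2: "0 \<le> 5 / 2 * (F * lg (D * Y))"
    using F lg_ge_1[of "D * Y"] by (intro mult_nonneg_nonneg) auto
  have ln_eq: "ln (D\<^sup>2 * sqrt D * Y) = ln Y + 5 / 2 * ln D" "ln (D * Y) = ln Y + ln D"
    using assms Y by (auto simp: ln_mult ln_realpow ln_sqrt)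
  have lnD: "0 \<le> ln D" using assms by simp
  have "F * lg (D\<^sup>2 * sqrt D * Y) \<le> 5 / 2 * (F * lg (D * Y))
      + 5 / 2 * (A * sqrt A) * (\<kappa>\<^sup>2 * D * lg (D / \<beta>) / \<alpha>\<^sup>2)"
  proof (cases "1 \<le> Y")
    case True
    then have "0 \<le> ln Y" by simp
    \<comment> \<open>Both branches of the maximum in \<open>lg\<close> are compared: 1 \<le> 5/2,
      and ln Y + 5/2 ln D \<le> 5/2 (ln Y + ln D) because ln Y \<ge> 0.\<close>
    then have "lg (D\<^sup>2 * sqrt D * Y) \<le> 5 / 2 * lg (D * Y)"
      using lnD by (auto simp: lg_def ln_eq max_def)
    then have "F * lg (D\<^sup>2 * sqrt D * Y) \<le> F * (5 / 2 * lg (D * Y))"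
      using F by (rule mult_left_mono)
    then show ?thesis using T1 by linarith
  next
    case False
    then have "ln Y \<le> 0" using Y by simp
    then have "lg (D\<^sup>2 * sqrt D * Y) \<le> 5 / 2 * lg D"
      using lnD by (auto simp: lg_def ln_eq max_def)
    also have "lg D \<le> lg (D / \<beta>)"
      using assms by (intro lg_mono) (auto simp: pos_le_divide_eq mult_left_le)
    finally have lg_le: "lg (D\<^sup>2 * sqrt D * Y) \<le> 5 / 2 * lg (D / \<beta>)" by simp
    have "\<kappa> * L < \<alpha> * \<beta> * \<rho>"
      using False assms by (simp add: Y_def)
    moreover have "1 \<le> \<kappa> * L" using assms mult_mono[of 1 \<kappa> 1 L] by simp
    moreover have "\<alpha> * \<beta> * \<rho> \<le> A * 1 * \<rho>"
      using assms by (intro mult_right_mono mult_mono) auto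
    ultimately have "1 \<le> sqrt (A * \<rho>)" by simp
    then have "1 \<le> sqrt A * sqrt \<rho>" by (simp add: real_sqrt_mult)
    moreover have "1 \<le> \<kappa> * A / \<alpha>"
      using assms mult_mono[of 1 \<kappa> \<alpha> A] by simp
    \<comment> \<open>Multiplying \<open>F\<close> by this quantity cancels sqrt \<rho> and supplies
      the missing \<kappa> / \<alpha>, which turns the prefactor of the second term into that of the
      first.\<close>
    ultimately have one: "1 \<le> (sqrt A * sqrt \<rho>) * (\<kappa> * A / \<alpha>)"
      using mult_mono[of 1 "sqrt A * sqrt \<rho>" 1 "\<kappa> * A / \<alpha>"] by simp
    have "F = F * 1" by simp
    also have "\<dots> \<le> F * ((sqrt A * sqrt \<rho>) * (\<kappa> * A / \<alpha>))"
      using one F by (rule mult_left_mono)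
    also have "\<dots> = A * sqrt A * (\<kappa>\<^sup>2 * D / \<alpha>\<^sup>2)"
      using assms by (simp add: F_def power2_eq_square)
    finally have "F * lg (D\<^sup>2 * sqrt D * Y)
        \<le> (A * sqrt A * (\<kappa>\<^sup>2 * D / \<alpha>\<^sup>2)) * (5 / 2 * lg (D / \<beta>))"
      using lg_le F lg_ge_1[of "D\<^sup>2 * sqrt D * Y"] by (intro mult_mono) auto
    also have "\<dots> = 5 / 2 * (A * sqrt A) * (\<kappa>\<^sup>2 * D * lg (D / \<beta>) / \<alpha>\<^sup>2)" by simp
    finally show ?thesis using T2 by linarith
  qed
  then show ?thesis by (simp add: F_def Y_def mult_ac)
qed

text \<open>Under the substitution the first and third terms become exactly the claimed ones; only
  the middle term needs \<open>NaivePME_lg_bound\<close>. The resulting constant depends on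
  \<open>A\<close> and \<open>C\<close> but not on \<open>d\<close>.\<close>

lemma NaivePME_sample_bound:
  fixes d :: nat and A \<alpha> \<beta> \<rho> \<kappa> R C :: real
  assumes "0 < \<alpha>" "\<alpha> \<le> A" "0 < \<beta>" "\<beta> \<le> 1" "0 < \<rho>" "1 \<le> \<kappa>" "1 \<le> d" "0 \<le> C"
  defines "\<rho>' \<equiv> \<rho> / real d" and "\<alpha>' \<equiv> \<alpha> / (\<kappa> * sqrt (real d))" and "\<beta>' \<equiv> \<beta> / real d"
  shows "C * (lg (1 / \<beta>') / \<alpha>'\<^sup>2 + lg (lg R / (\<alpha>' * \<beta>' * \<rho>')) / (\<alpha>' * sqrt \<rho>') + sqrt (lg (R / \<beta>')) / sqrt \<rho>')
    \<le> C * (5 / 2 + 5 / 2 * (A * sqrt A)) * (\<kappa>\<^sup>2 * real d * lg (real d / \<beta>) / \<alpha>\<^sup>2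
        + \<kappa> * real d * lg (\<kappa> * real d * lg R / (\<alpha> * \<beta> * \<rho>)) / (\<alpha> * sqrt \<rho>)
        + sqrt (real d) * sqrt (lg (R * real d / \<beta>)) / sqrt \<rho>)"
proof -
  define D where "D = real d"
  have D: "1 \<le> D" using assms by (simp add: D_def)
  define T1 T2 T3 where "T1 = \<kappa>\<^sup>2 * D * lg (D / \<beta>) / \<alpha>\<^sup>2"
    and "T2 = \<kappa> * D * lg (\<kappa> * D * lg R / (\<alpha> * \<beta> * \<rho>)) / (\<alpha> * sqrt \<rho>)"
    and "T3 = sqrt D * sqrt (lg (R * D / \<beta>)) / sqrt \<rho>"
  define B where "B = A * sqrt A"
  have B: "0 \<le> B" using assms by (simp add: B_def)
  have lg0: "0 \<le> lg x" for x using lg_ge_1[of x] by simp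
  have nonneg: "0 \<le> T1" "0 \<le> T2" "0 \<le> T3"
    using assms D lg0 by (auto simp: T1_def T2_def T3_def intro!: mult_nonneg_nonneg divide_nonneg_nonneg)
  have T1_eq: "lg (1 / \<beta>') / \<alpha>'\<^sup>2 = T1"
    using assms D by (simp add: \<beta>'_def \<alpha>'_def T1_def D_def power_divide power_mult_distrib)
  have T3_eq: "sqrt (lg (R / \<beta>')) / sqrt \<rho>' = T3"
    using assms D by (simp add: \<beta>'_def \<rho>'_def T3_def D_def real_sqrt_divide)
  have bound: "lg (lg R / (\<alpha>' * \<beta>' * \<rho>')) / (\<alpha>' * sqrt \<rho>') \<le> 5 / 2 * T2 + 5 / 2 * B * T1"
  proof -
    have "lg R / (\<alpha>' * \<beta>' * \<rho>') = \<kappa> * (D\<^sup>2 * sqrt D) * lg R / (\<alpha> * \<beta> * \<rho>)"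
      using assms D by (simp add: \<alpha>'_def \<beta>'_def \<rho>'_def D_def power2_eq_square)
    moreover have "\<alpha>' * sqrt \<rho>' = \<alpha> * sqrt \<rho> / (\<kappa> * D)"
      using assms D by (simp add: \<alpha>'_def \<rho>'_def D_def real_sqrt_divide)
    ultimately have "lg (lg R / (\<alpha>' * \<beta>' * \<rho>')) / (\<alpha>' * sqrt \<rho>')
        = \<kappa> * D * lg (\<kappa> * (D\<^sup>2 * sqrt D) * lg R / (\<alpha> * \<beta> * \<rho>)) / (\<alpha> * sqrt \<rho>)"
      by simp
    then show ?thesis
      unfolding T1_def T2_def B_def
      using NaivePME_lg_bound[of \<alpha> A \<beta> \<rho> \<kappa> D "lg R"] assms D lg_ge_1[of R] by simp
  qed
  have "lg (1 / \<beta>') / \<alpha>'\<^sup>2 + lg (lg R / (\<alpha>' * \<beta>' * \<rho>')) / (\<alpha>' * sqrt \<rho>') + sqrt (lg (R / \<beta>')) / sqrt \<rho>'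
      \<le> (5 / 2 + 5 / 2 * B) * (T1 + T2 + T3)"
  proof -
    \<comment> \<open>The coefficients reached are 1 + 5/2 B, 5/2 and 1, each at most 5/2 + 5/2
      B.\<close>
    have "(5 / 2 + 5 / 2 * B) * (T1 + T2 + T3)
        = 5 / 2 * T1 + 5 / 2 * T2 + 5 / 2 * T3 + 5 / 2 * B * T1 + 5 / 2 * (B * T2) + 5 / 2 * (B * T3)"
      by (simp add: algebra_simps add_divide_distrib)
    then show ?thesis
      using bound nonneg mult_nonneg_nonneg[OF B nonneg(2)] mult_nonneg_nonneg[OF B nonneg(3)]
      unfolding T1_eq T3_eq by linarith
  qed
  from mult_left_mono[OF this \<open>0 \<le> C\<close>] show ?thesis
    by (simp only: T1_def T2_def T3_def D_def B_def mult.assoc)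
qed

theorem theorem4p2:
  fixes KVMean ::
    "real \<Rightarrow> real \<Rightarrow> real \<Rightarrow> real \<Rightarrow> real \<Rightarrow> nat \<Rightarrow> (nat \<Rightarrow> real) \<Rightarrow> real measure"
  assumes KVMean_private:
    "\<And>\<rho> \<alpha> \<beta> R \<kappa>. \<lbrakk>\<rho> > 0; \<alpha> > 0; \<beta> > 0; R > 0; \<kappa> > 0\<rbrakk> \<Longrightarrow>
       zCDP borel borel \<rho> (KVMean \<rho> \<alpha> \<beta> R \<kappa>)"
  assumes KVMean_accurate:
    "\<And>A. A > 0 \<Longrightarrow> \<exists>C>0. \<forall>\<rho>>0. \<forall>\<alpha>>0. \<forall>\<beta>>0. \<forall>R>0. \<forall>\<kappa>>0. \<alpha> \<le> A \<longrightarrow>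
       (\<exists>n::nat.
          real n \<le> C * (lg (1 / \<beta>) / \<alpha>\<^sup>2
                        + lg (lg R / (\<alpha> * \<beta> * \<rho>)) / (\<alpha> * sqrt \<rho>)
                        + sqrt (lg (R / \<beta>)) / sqrt \<rho>) \<and>
          (\<forall>\<mu> \<sigma>. \<bar>\<mu>\<bar> \<le> R \<longrightarrow> \<sigma> > 0 \<longrightarrow> 1 \<le> \<sigma>\<^sup>2 \<longrightarrow> \<sigma>\<^sup>2 \<le> \<kappa> \<longrightarrow>
             \<P>(m in output_on_samples (KVMean \<rho> \<alpha> \<beta> R \<kappa>) n (density lborel (normal_density \<mu> \<sigma>)).
                \<bar>\<mu> - m\<bar> \<le> \<alpha> * \<kappa>) \<ge> 1 - \<beta>))"
  shows
    "(\<forall>d\<ge>1. \<forall>\<rho>>0. \<forall>\<alpha>>0. \<forall>\<beta>>0. \<forall>R>0. \<forall>\<kappa>>0.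
        zCDP (Rvec d) (Rvec d) \<rho> (NaivePME KVMean d \<rho> \<alpha> \<beta> R \<kappa>)) \<and>
     (\<forall>A>0. \<exists>C>0. \<forall>d\<ge>1. \<forall>\<rho>>0. \<forall>\<alpha>>0. \<forall>\<beta>>0. \<forall>R>0. \<forall>\<kappa>>0. \<alpha> \<le> A \<longrightarrow>
       (\<exists>n::nat.
          real n \<le> C * (\<kappa>\<^sup>2 * real d * lg (real d / \<beta>) / \<alpha>\<^sup>2
                        + \<kappa> * real d * lg (\<kappa> * real d * lg R / (\<alpha> * \<beta> * \<rho>)) / (\<alpha> * sqrt \<rho>)
                        + sqrt (real d) * sqrt (lg (R * real d / \<beta>)) / sqrt \<rho>) \<and>
          (\<forall>\<mu>. \<forall>\<Sigma>\<in>carrier_mat d d.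
             L2_set \<mu> {..<d} \<le> R \<longrightarrow> 1\<^sub>m d \<preceq> \<Sigma> \<longrightarrow> \<Sigma> \<preceq> \<kappa> \<cdot>\<^sub>m 1\<^sub>m d \<longrightarrow>
             \<P>(m in output_on_samples (NaivePME KVMean d \<rho> \<alpha> \<beta> R \<kappa>) n (mv_gaussian d \<mu> \<Sigma>).
                norm_wrt d \<Sigma> (\<lambda>j. \<mu> j - m j) \<le> \<alpha>) \<ge> 1 - \<beta>)))"
proof (intro conjI allI impI)
  fix d :: nat and \<rho> \<alpha> \<beta> R \<kappa> :: real
  assume "1 \<le> d" "0 < \<rho>" "0 < \<alpha>" "0 < \<beta>" "0 < R" "0 < \<kappa>"
  then show "zCDP (Rvec d) (Rvec d) \<rho> (NaivePME KVMean d \<rho> \<alpha> \<beta> R \<kappa>)"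
    by (intro zCDP_NaivePME KVMean_private)
next
  fix A :: real assume A: "0 < A"
  obtain C where C: "0 < C" and acc: "\<forall>\<rho>>0. \<forall>\<alpha>>0. \<forall>\<beta>>0. \<forall>R>0. \<forall>\<kappa>>0. \<alpha> \<le> A \<longrightarrow>
       (\<exists>n::nat.
          real n \<le> C * (lg (1 / \<beta>) / \<alpha>\<^sup>2
                        + lg (lg R / (\<alpha> * \<beta> * \<rho>)) / (\<alpha> * sqrt \<rho>)
                        + sqrt (lg (R / \<beta>)) / sqrt \<rho>) \<and>
          (\<forall>\<mu> \<sigma>. \<bar>\<mu>\<bar> \<le> R \<longrightarrow> \<sigma> > 0 \<longrightarrow> 1 \<le> \<sigma>\<^sup>2 \<longrightarrow> \<sigma>\<^sup>2 \<le> \<kappa> \<longrightarrow>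
             \<P>(m in output_on_samples (KVMean \<rho> \<alpha> \<beta> R \<kappa>) n (density lborel (normal_density \<mu> \<sigma>)).
                \<bar>\<mu> - m\<bar> \<le> \<alpha> * \<kappa>) \<ge> 1 - \<beta>))"
    using KVMean_accurate[OF A] by blast
  \<comment> \<open>Chosen before \<open>d\<close> and the other parameters, as the order of
    quantifiers demands.\<close>
  define C' where "C' = C * (5 / 2 + 5 / 2 * (A * sqrt A))"
  have C': "0 < C'" using C A by (simp add: C'_def add_pos_nonneg)
  show "\<exists>C>0. \<forall>d\<ge>1. \<forall>\<rho>>0. \<forall>\<alpha>>0. \<forall>\<beta>>0. \<forall>R>0. \<forall>\<kappa>>0. \<alpha> \<le> A \<longrightarrow>
       (\<exists>n::nat.
          real n \<le> C * (\<kappa>\<^sup>2 * real d * lg (real d / \<beta>) / \<alpha>\<^sup>2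
                        + \<kappa> * real d * lg (\<kappa> * real d * lg R / (\<alpha> * \<beta> * \<rho>)) / (\<alpha> * sqrt \<rho>)
                        + sqrt (real d) * sqrt (lg (R * real d / \<beta>)) / sqrt \<rho>) \<and>
          (\<forall>\<mu>. \<forall>\<Sigma>\<in>carrier_mat d d.
             L2_set \<mu> {..<d} \<le> R \<longrightarrow> 1\<^sub>m d \<preceq> \<Sigma> \<longrightarrow> \<Sigma> \<preceq> \<kappa> \<cdot>\<^sub>m 1\<^sub>m d \<longrightarrow>
             \<P>(m in output_on_samples (NaivePME KVMean d \<rho> \<alpha> \<beta> R \<kappa>) n (mv_gaussian d \<mu> \<Sigma>).
                norm_wrt d \<Sigma> (\<lambda>j. \<mu> j - m j) \<le> \<alpha>) \<ge> 1 - \<beta>))"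
  proof (intro exI[of _ C'] conjI allI impI C')
    fix d :: nat and \<rho> \<alpha> \<beta> R \<kappa> :: real
    assume d: "1 \<le> d" and pos: "0 < \<rho>" "0 < \<alpha>" "0 < \<beta>" "0 < R" "0 < \<kappa>" and \<alpha>A: "\<alpha> \<le> A"
    let ?bound = "C' * (\<kappa>\<^sup>2 * real d * lg (real d / \<beta>) / \<alpha>\<^sup>2
        + \<kappa> * real d * lg (\<kappa> * real d * lg R / (\<alpha> * \<beta> * \<rho>)) / (\<alpha> * sqrt \<rho>)
        + sqrt (real d) * sqrt (lg (R * real d / \<beta>)) / sqrt \<rho>)"
    let ?accurate = "\<lambda>n. \<forall>\<mu>. \<forall>\<Sigma>\<in>carrier_mat d d.
        L2_set \<mu> {..<d} \<le> R \<longrightarrow> 1\<^sub>m d \<preceq> \<Sigma> \<longrightarrow> \<Sigma> \<preceq> \<kappa> \<cdot>\<^sub>m 1\<^sub>m d \<longrightarrow>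
        \<P>(m in output_on_samples (NaivePME KVMean d \<rho> \<alpha> \<beta> R \<kappa>) n (mv_gaussian d \<mu> \<Sigma>).
          norm_wrt d \<Sigma> (\<lambda>j. \<mu> j - m j) \<le> \<alpha>) \<ge> 1 - \<beta>"
    have d0: "0 < d" using d by simp
    show "\<exists>n::nat. real n \<le> ?bound \<and> ?accurate n"
    \<comment> \<open>Outside this range \<open>n = 0\<close> suffices: for \<kappa> < 1 no \<Sigma>
      is admissible, and for \<beta> \<ge> 1 the required probability is at most 0. Inside it the
      conditions of \<open>NaivePME_sample_bound\<close> hold.\<close>
    proof (cases "1 \<le> \<kappa> \<and> \<beta> < 1")
      case False
      have "0 \<le> lg x" for x using lg_ge_1[of x] by simp
      then have "real 0 \<le> ?bound"
        using C' pos by (auto intro!: mult_nonneg_nonneg add_nonneg_nonneg divide_nonneg_nonneg)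
      moreover have "?accurate 0"
      proof (intro allI ballI impI)
        fix \<mu> \<Sigma>
        assume "\<Sigma> \<in> carrier_mat d d" "1\<^sub>m d \<preceq> \<Sigma>" "\<Sigma> \<preceq> \<kappa> \<cdot>\<^sub>m 1\<^sub>m d"
        then have "1 \<le> \<kappa>" using loewner_diag[of \<Sigma> d \<kappa> 0] d0 by simp
        with False have "1 - \<beta> \<le> 0" by simp
        then show "1 - \<beta> \<le> \<P>(m in output_on_samples (NaivePME KVMean d \<rho> \<alpha> \<beta> R \<kappa>) 0 (mv_gaussian d \<mu> \<Sigma>).
            norm_wrt d \<Sigma> (\<lambda>j. \<mu> j - m j) \<le> \<alpha>)"
          by (rule order_trans) (rule measure_nonneg)
      qed
      ultimately show ?thesis by blast
    next
      case True
      define \<rho>' \<alpha>' \<beta>' where "\<rho>' = \<rho> / real d" and "\<alpha>' = \<alpha> / (\<kappa> * sqrt (real d))" and "\<beta>' = \<beta> / real d"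
      have pos': "0 < \<rho>'" "0 < \<alpha>'" "0 < \<beta>'"
        using d pos by (auto simp: \<rho>'_def \<alpha>'_def \<beta>'_def)
      \<comment> \<open>The univariate guarantee with constant \<open>C\<close> covers only
        accuracies up to \<open>A\<close>, so the rescaled accuracy must not exceed
        \<alpha>.\<close>
      have "1 \<le> \<kappa> * sqrt (real d)"
        using True d mult_mono[of 1 \<kappa> 1 "sqrt (real d)"] by simp
      then have "\<alpha>' \<le> \<alpha>"
        using pos by (simp add: \<alpha>'_def divide_le_eq mult_le_cancel_left1)
      with \<alpha>A have \<alpha>'A: "\<alpha>' \<le> A" by simp
      obtain n :: nat where
        n: "real n \<le> C * (lg (1 / \<beta>') / \<alpha>'\<^sup>2 + lg (lg R / (\<alpha>' * \<beta>' * \<rho>')) / (\<alpha>' * sqrt \<rho>') + sqrt (lg (R / \<beta>')) / sqrt \<rho>')"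
        and KV_acc: "\<forall>\<mu> \<sigma>. \<bar>\<mu>\<bar> \<le> R \<longrightarrow> \<sigma> > 0 \<longrightarrow> 1 \<le> \<sigma>\<^sup>2 \<longrightarrow> \<sigma>\<^sup>2 \<le> \<kappa> \<longrightarrow>
          \<P>(m in output_on_samples (KVMean \<rho>' \<alpha>' \<beta>' R \<kappa>) n (density lborel (normal_density \<mu> \<sigma>)).
            \<bar>\<mu> - m\<bar> \<le> \<alpha>' * \<kappa>) \<ge> 1 - \<beta>'"
        using acc[rule_format, OF pos' pos(4,5) \<alpha>'A] by blast
      note n
      also have "C * (lg (1 / \<beta>') / \<alpha>'\<^sup>2 + lg (lg R / (\<alpha>' * \<beta>' * \<rho>')) / (\<alpha>' * sqrt \<rho>') + sqrt (lg (R / \<beta>')) / sqrt \<rho>')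
          \<le> ?bound"
        unfolding \<rho>'_def \<alpha>'_def \<beta>'_def C'_def
        using True d pos \<alpha>A C by (intro NaivePME_sample_bound) auto
      finally have "real n \<le> ?bound" .
      moreover have "?accurate n"
      proof (intro allI ballI impI)
        fix \<mu> \<Sigma>
        assume "\<Sigma> \<in> carrier_mat d d" "L2_set \<mu> {..<d} \<le> R" "1\<^sub>m d \<preceq> \<Sigma>" "\<Sigma> \<preceq> \<kappa> \<cdot>\<^sub>m 1\<^sub>m d"
        moreover have "randomized_algorithm borel borel (KVMean \<rho>' \<alpha>' \<beta>' R \<kappa>)"
          using KVMean_private[OF pos' pos(4,5)] by (simp add: zCDP_def)
        moreover have "randomized_algorithm (Rvec d) (Rvec d) (NaivePME KVMean d \<rho> \<alpha> \<beta> R \<kappa>)"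
          using d pos KVMean_private by (intro randomized_algorithm_NaivePME) (auto simp: zCDP_def)
        ultimately show "1 - \<beta> \<le> \<P>(m in output_on_samples (NaivePME KVMean d \<rho> \<alpha> \<beta> R \<kappa>) n (mv_gaussian d \<mu> \<Sigma>).
            norm_wrt d \<Sigma> (\<lambda>j. \<mu> j - m j) \<le> \<alpha>)"
          using KV_acc d0 pos unfolding \<rho>'_def \<alpha>'_def \<beta>'_def
          by (intro NaivePME_accurate) auto
      qed
      ultimately show ?thesis by blast
    qed
  qed
qed

end
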